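(* Let $N\in\mathbb N$, $q=1/N$, $\lambda\in\mathrm{Par}(n)$, and let $h$ be a vector in a real Hilbert space with $\|h\|^2=N$. Then $\mathcal E[W(\chi^\lambda\otimes h^{\otimes n})]$, regarded as a symmetric polynomial in the eigenvalues $x_1,\dots,x_N$, is a multiple of the Hermite polynomial of matrix argument (for $\beta=2$) indexed by $\lambda$.
   Context: $[n]=\{1,\dots,n\}$; $S(n)$ is the permutation group of $[n]$; $\mathrm{Par}(n)$ the set of partitions of $n$; $\chi^\lambda$ is the irreducible character of $S(n)$ indexed by $\lambda$, identified with $\sum_{\alpha\in S(n)}\chi^\lambda(\alpha)\alpha\in\mathbb C[S(n)]$. The polynomial $\mathcal E[W(\eta\otimes h^{\otimes n})]$. For $\beta\in S(m)$ with cycle lengths $\mu_1,\dots,\mu_k$, let $p_\beta(x_1,\dots,x_N)=\prod_i(x_1^{\mu_i}+\dots+x_N^{\mu_i})$ (this is $\prod_i\mathrm{Tr}[X^{\mu_i}]$ for a matrix $X$ with eigenvalues $x_1,\dots,x_N$), extended linearly to $\mathbb C[S(m)]$. $\mathcal P_{1,2}(n)$ is the set of partitions $\pi$ of $[n]$ into blocks of size 1 and 2, identified with the involution swapping the elements of each pair; $|\pi|$ is the number of pairs, $\mathrm{supp}(\pi)$ their union. For $\alpha\in S(n)$ and $S\subset[n]$, $\alpha|_{S^c}$ is the permutation of $[n]\setminus S$ obtained by erasing $S$ from the cycles: $x\mapsto\alpha^m(x)$, $m=\min\{j>0:\alpha^j(x)\notin S\}$. With $\mathrm{cyc}$ the number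 of cycles (fixed points included) and $\ell=|\pi|$, the contraction is $$C_\pi(\alpha)=q^{\mathrm{cyc}((\pi\alpha)|_{\mathrm{supp}(\pi)^c})-\mathrm{cyc}(\pi\alpha)+\ell}\,P\big((\pi\alpha)|_{\mathrm{supp}(\pi)^c}\big)\in\mathbb C[S(n-2\ell)],$$ where $P$ relabels $[n]\setminus\mathrm{supp}(\pi)$ by $[n-2\ell]$ order-preservingly. For $\eta\in\mathbb C[S(n)]$, $$\mathcal E[W(\eta\otimes h^{\otimes n})]=\sum_{\pi\in\mathcal P_{1,2}(n)}(-1)^{|\pi|}\|h\|^{2|\pi|}\,p_{C_\pi(\eta)}(x_1,\dots,x_N)$$ (for $X(h)$ an $N\times N$ Hermitian Gaussian matrix with $\mathbb E[X(h)_{ij}X(h)_{k\ell}]=\frac1N\delta_{i=\ell}\delta_{j=k}\|h\|^2$ and eigenvalues $x_i$, this is the Hermite trace polynomial evaluated at $X(h)$, with the factor $I_N$ dropped). Hermite polynomials of matrix argument. Let $$D^*=\sum_{i=1}^N\frac{\partial^2}{\partial x_i^2}+\sum_{i\ne j}\frac1{x_i-x_j}\Big(\frac\partial{\partial x_i}-\frac\partial{\partial x_j}\Big),\qquad E^*=\sum_{i=1}^Nx_i\frac\partial{\partial x_i}.$$ For $\lambda\in\mathrm{Par}(n)$ the Hermite polynomial of matrix argument (for $\beta=2$) is the symmetric polynomial in $x_1,\dots,x_N$ with leading (top-degree) term $\frac{n!}{c_\lambda}s_\lambda$ which is an eigenfunction of $D^*-E^*$ with eigenvalue $-n$. Here $s_\lambda=\frac1{n!}\sum_{\alpha\in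 S(n)}\chi^\lambda(\alpha)p_\alpha$ is the Schur polynomial and $c_\lambda=\prod_{(i,j)\in\lambda}(\lambda_i+\lambda_j'-i-j+1)$ is the product of hook lengths, with $\lambda'$ the conjugate partition. *)

theory Defs
  imports "HOL-Analysis.Analysis" "HOL-Combinatorics.Combinatorics" "HOL-Library.Disjoint_Sets"
    "HOL-Library.Function_Algebras"
begin

section \<open>The group algebra of the symmetric group\<close>

text \<open>
  \<open>S(n)\<close> is the set of functions on \<open>nat\<close> that permute \<open>{1..n}\<close> (and fix everything else).
  An element \<open>\<Sum> \<eta>(\<alpha>) \<alpha>\<close> of the complex group algebra is its coefficient function \<open>\<eta>\<close>.
\<close>

type_synonym galg = "(nat \<Rightarrow> nat) \<Rightarrow> complex"

definition SymGrp :: "nat \<Rightarrow> (nat \<Rightarrow> nat) set" where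
  "SymGrp n = {\<alpha>. \<alpha> permutes {1..n}}"

definition gconv :: "nat \<Rightarrow> galg \<Rightarrow> galg \<Rightarrow> galg" where
  "gconv n f g = (\<lambda>\<alpha>. \<Sum>\<beta>\<in>SymGrp n. f \<beta> * g (inv \<beta> \<circ> \<alpha>))"

definition gunit :: "(nat \<Rightarrow> nat) \<Rightarrow> galg" where
  "gunit \<alpha> = (\<lambda>\<beta>. if \<beta> = \<alpha> then 1 else 0)"

global_interpretation galg: vector_space "\<lambda>(c::complex) (f::galg) \<alpha>. c * f \<alpha>"
  by unfold_locales (auto simp: algebra_simps fun_eq_iff)

text \<open>Trace of a linear operator \<open>T\<close> on a finite-dimensional \<open>T\<close>-invariant subspace \<open>V\<close>.\<close>

definition trace_on :: "galg set \<Rightarrow> (galg \<Rightarrow> galg) \<Rightarrow> complex" where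
  "trace_on V T = (let B = (SOME B. galg.independent B \<and> galg.span B = V)
                   in \<Sum>b\<in>B. galg.representation B (T b) b)"

section \<open>Partitions and irreducible characters\<close>

definition Par :: "nat \<Rightarrow> nat list set" where
  "Par n = {lam. sorted_wrt (\<ge>) lam \<and> (\<forall>r\<in>set lam. 0 < r) \<and> sum_list lam = n}"

definition conj_part :: "nat list \<Rightarrow> nat \<Rightarrow> nat" where
  "conj_part lam j = card {i\<in>{1..length lam}. j \<le> lam ! (i - 1)}"

definition hook_prod :: "nat list \<Rightarrow> nat" where
  "hook_prod lam = (\<Prod>i=1..length lam. \<Prod>j=1..lam ! (i - 1).
                      lam ! (i - 1) + conj_part lam j - i - j + 1)"

text \<open>
  Row and column of the entry \<open>k\<close> in the tableau of shape \<open>lam\<close> that is filled with \<open>1, ..., n\<close>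
  row by row (rows numbered from 0, columns from 1).
\<close>

definition tab_row :: "nat list \<Rightarrow> nat \<Rightarrow> nat" where
  "tab_row lam k = (LEAST i. k \<le> sum_list (take (Suc i) lam))"

definition tab_col :: "nat list \<Rightarrow> nat \<Rightarrow> nat" where
  "tab_col lam k = k - sum_list (take (tab_row lam k) lam)"

definition row_sym :: "nat \<Rightarrow> nat list \<Rightarrow> galg" where
  "row_sym n lam = (\<lambda>\<alpha>. if \<alpha> \<in> SymGrp n \<and> (\<forall>k\<in>{1..n}. tab_row lam (\<alpha> k) = tab_row lam k)
                          then 1 else 0)"

definition col_antisym :: "nat \<Rightarrow> nat list \<Rightarrow> galg" where
  "col_antisym n lam = (\<lambda>\<alpha>. if \<alpha> \<in> SymGrp n \<and> (\<forall>k\<in>{1..n}. tab_col lam (\<alpha> k) = tab_col lam k)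
                              then of_int (sign \<alpha>) else 0)"

definition young_symmetrizer :: "nat \<Rightarrow> nat list \<Rightarrow> galg" where
  "young_symmetrizer n lam = gconv n (row_sym n lam) (col_antisym n lam)"

text \<open>
  The irreducible (Specht) module of \<open>lam\<close> is the left ideal generated by the Young symmetrizer,
  and the irreducible character is the trace of left multiplication on it.
\<close>

definition specht :: "nat \<Rightarrow> nat list \<Rightarrow> galg set" where
  "specht n lam = range (\<lambda>f. gconv n f (young_symmetrizer n lam))"

definition irr_char :: "nat \<Rightarrow> nat list \<Rightarrow> galg" where
  "irr_char n lam = (\<lambda>\<alpha>. if \<alpha> \<in> SymGrp n
                          then trace_on (specht n lam) (gconv n (gunit \<alpha>)) else 0)"

section \<open>Power sums\<close>

text \<open>
  A polynomial in \<open>x\<^sub>1, ..., x\<^sub>N\<close> is represented by the polynomial function it induces on families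
  \<open>x :: nat \<Rightarrow> complex\<close>, of which only the entries with index in \<open>{1..N}\<close> are used.
  Note that \<open>orbit \<alpha> k\<close> is the (support of the) cycle of \<open>\<alpha>\<close> through \<open>k\<close>.
\<close>

definition cycles_on :: "nat set \<Rightarrow> (nat \<Rightarrow> nat) \<Rightarrow> nat set set" where
  "cycles_on A \<alpha> = orbit \<alpha> ` A"

definition cyc :: "nat set \<Rightarrow> (nat \<Rightarrow> nat) \<Rightarrow> nat" where
  "cyc A \<alpha> = card (cycles_on A \<alpha>)"

definition psum_perm :: "nat \<Rightarrow> nat \<Rightarrow> (nat \<Rightarrow> nat) \<Rightarrow> (nat \<Rightarrow> complex) \<Rightarrow> complex" where
  "psum_perm N m \<beta> x = (\<Prod>c\<in>cycles_on {1..m} \<beta>. \<Sum>i=1..N. x i ^ card c)"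

definition psum :: "nat \<Rightarrow> nat \<Rightarrow> galg \<Rightarrow> (nat \<Rightarrow> complex) \<Rightarrow> complex" where
  "psum N m \<eta> x = (\<Sum>\<beta>\<in>SymGrp m. \<eta> \<beta> * psum_perm N m \<beta> x)"

section \<open>Contractions and the expectation\<close>

definition P12 :: "nat \<Rightarrow> nat set set set" where
  "P12 n = {\<pi>. partition_on {1..n} \<pi> \<and> (\<forall>B\<in>\<pi>. card B = 1 \<or> card B = 2)}"

definition pairs :: "nat set set \<Rightarrow> nat set set" where
  "pairs \<pi> = {B\<in>\<pi>. card B = 2}"

definition pair_supp :: "nat set set \<Rightarrow> nat set" where
  "pair_supp \<pi> = \<Union>(pairs \<pi>)"

definition pair_invol :: "nat set set \<Rightarrow> nat \<Rightarrow> nat" where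
  "pair_invol \<pi> x = (if x \<in> pair_supp \<pi> then (THE y. y \<noteq> x \<and> {x, y} \<in> \<pi>) else x)"

text \<open>Erasing the elements of \<open>S\<close> from the cycles of \<open>\<alpha>\<close>; elements of \<open>S\<close> become fixed points.\<close>

definition erase :: "nat set \<Rightarrow> (nat \<Rightarrow> nat) \<Rightarrow> nat \<Rightarrow> nat" where
  "erase S \<alpha> x = (if x \<in> S then x else (\<alpha> ^^ (LEAST j. 0 < j \<and> (\<alpha> ^^ j) x \<notin> S)) x)"

text \<open>Order-preserving relabelling of a finite set \<open>A\<close> of naturals by \<open>{1..card A}\<close>.\<close>

definition rank_in :: "nat set \<Rightarrow> nat \<Rightarrow> nat" where
  "rank_in A x = card {y\<in>A. y \<le> x}"

definition relabel :: "nat set \<Rightarrow> (nat \<Rightarrow> nat) \<Rightarrow> nat \<Rightarrow> nat" where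
  "relabel A \<sigma> k = (if k \<in> {1..card A} then rank_in A (\<sigma> (inv_into A (rank_in A) k)) else k)"

definition contraction_perm :: "real \<Rightarrow> nat \<Rightarrow> nat set set \<Rightarrow> (nat \<Rightarrow> nat) \<Rightarrow> galg" where
  "contraction_perm q n \<pi> \<alpha> =
     (let A = {1..n} - pair_supp \<pi>;
          \<sigma> = pair_invol \<pi> \<circ> \<alpha>;
          \<rho> = erase (pair_supp \<pi>) \<sigma>
      in (\<lambda>\<beta>. complex_of_real (q powi (int (cyc A \<rho>) - int (cyc {1..n} \<sigma>) + int (card (pairs \<pi>))))
              * gunit (relabel A \<rho>) \<beta>))"

definition contraction :: "real \<Rightarrow> nat \<Rightarrow> nat set set \<Rightarrow> galg \<Rightarrow> galg" where
  "contraction q n \<pi> \<eta> = (\<lambda>\<beta>. \<Sum>\<alpha>\<in>SymGrp n. \<eta> \<alpha> * contraction_perm q n \<pi> \<alpha> \<beta>)"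

definition expect_W ::
  "real \<Rightarrow> nat \<Rightarrow> nat \<Rightarrow> galg \<Rightarrow> 'h::real_inner \<Rightarrow> (nat \<Rightarrow> complex) \<Rightarrow> complex" where
  "expect_W q N n \<eta> h x =
     (\<Sum>\<pi>\<in>P12 n. (- 1) ^ card (pairs \<pi>) * complex_of_real (norm h ^ (2 * card (pairs \<pi>)))
                  * psum N (n - 2 * card (pairs \<pi>)) (contraction q n \<pi> \<eta>) x)"

section \<open>Hermite polynomials of matrix argument\<close>

text \<open>\<open>f\<close> is a polynomial in \<open>x\<^sub>1, ..., x\<^sub>N\<close>, all of whose monomials have total degree below \<open>d\<close>.\<close>

definition poly_below :: "nat \<Rightarrow> nat \<Rightarrow> ((nat \<Rightarrow> complex) \<Rightarrow> complex) \<Rightarrow> bool" where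
  "poly_below N d f \<longleftrightarrow>
     (\<exists>(M :: (nat \<Rightarrow> nat) set) c. finite M \<and> (\<forall>m\<in>M. (\<Sum>i=1..N. m i) < d) \<and>
        f = (\<lambda>x. \<Sum>m\<in>M. c m * (\<Prod>i=1..N. x i ^ m i)))"

definition sym_poly :: "nat \<Rightarrow> ((nat \<Rightarrow> complex) \<Rightarrow> complex) \<Rightarrow> bool" where
  "sym_poly N f \<longleftrightarrow> (\<exists>d. poly_below N d f) \<and> (\<forall>\<sigma>. \<sigma> permutes {1..N} \<longrightarrow> (\<forall>x. f (x \<circ> \<sigma>) = f x))"

definition pderiv_at :: "nat \<Rightarrow> ((nat \<Rightarrow> complex) \<Rightarrow> complex) \<Rightarrow> (nat \<Rightarrow> complex) \<Rightarrow> complex" where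
  "pderiv_at i f x = deriv (\<lambda>t. f (x(i := t))) (x i)"

definition D_star :: "nat \<Rightarrow> ((nat \<Rightarrow> complex) \<Rightarrow> complex) \<Rightarrow> (nat \<Rightarrow> complex) \<Rightarrow> complex" where
  "D_star N f x = (\<Sum>i=1..N. pderiv_at i (pderiv_at i f) x)
     + (\<Sum>i=1..N. \<Sum>j\<in>{1..N} - {i}. 1 / (x i - x j) * (pderiv_at i f x - pderiv_at j f x))"

definition E_star :: "nat \<Rightarrow> ((nat \<Rightarrow> complex) \<Rightarrow> complex) \<Rightarrow> (nat \<Rightarrow> complex) \<Rightarrow> complex" where
  "E_star N f x = (\<Sum>i=1..N. x i * pderiv_at i f x)"

definition schur :: "nat \<Rightarrow> nat \<Rightarrow> nat list \<Rightarrow> (nat \<Rightarrow> complex) \<Rightarrow> complex" where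
  "schur N n lam x = 1 / fact n * (\<Sum>\<alpha>\<in>SymGrp n. irr_char n lam \<alpha> * psum_perm N n \<alpha> x)"

text \<open>
  The eigenvalue equation is required where the coordinates are pairwise distinct, which is where
  the differential operator is defined by its formula; for polynomials this determines it
  everywhere. Since the Schur polynomial is homogeneous of degree \<open>n\<close>, the last clause prescribes
  the leading term. If \<open>lam\<close> has more than \<open>N\<close> parts, the Schur polynomial vanishes and the
  Hermite polynomial is 0.
\<close>

definition is_hermite :: "nat \<Rightarrow> nat \<Rightarrow> nat list \<Rightarrow> ((nat \<Rightarrow> complex) \<Rightarrow> complex) \<Rightarrow> bool" where
  "is_hermite N n lam H \<longleftrightarrow>
     sym_poly N H \<and>
     (\<forall>x. inj_on x {1..N} \<longrightarrow> D_star N H x - E_star N H x = - of_nat n * H x) \<and>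
     poly_below N n (\<lambda>x. H x - fact n / of_nat (hook_prod lam) * schur N n lam x)"

definition hermite_matrix :: "nat \<Rightarrow> nat \<Rightarrow> nat list \<Rightarrow> (nat \<Rightarrow> complex) \<Rightarrow> complex" where
  "hermite_matrix N n lam = (THE H. is_hermite N n lam H)"

end

theory Submission
  imports Defs
begin

text \<open>
  The eigenvalue equation already holds when the character is replaced by a single permutation
  \<open>\<alpha>\<close>; the character enters through the leading term.

  Identify a pairing with its involution \<open>p\<close>, with support \<open>S\<close>. With \<open>P\<^sub>k = \<Sum>\<^sub>i x\<^sub>i\<^sup>k\<close>, so that
  \<open>P\<^sub>0 = N\<close>, the power of \<open>q\<close> in the contraction times \<open>N\<^sup>\<ell>\<close> supplies one factor \<open>P\<^sub>0\<close> for every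
  cycle of \<open>p \<circ> \<alpha>\<close> that erasing \<open>S\<close> destroys. Hence the summand of \<open>p\<close> is \<open>\<plusminus>T(p)\<close>, where \<open>T(p)\<close> is
  the product of \<open>P\<^sub>k\<close> over all cycles \<open>c\<close> of \<open>p \<circ> \<alpha>\<close>, with \<open>k\<close> the number of elements of \<open>c\<close>
  outside \<open>S\<close> (\<open>gap_psum_erase\<close>, \<open>expect_W_eq\<close>). It is the trace monomial of \<open>p \<circ> \<alpha>\<close> with the
  matrix \<open>X\<close> at the positions outside \<open>S\<close> and the identity at those in \<open>S\<close>.

  The operator \<open>D\<^sup>*\<close> is the Laplacian of the space of Hermitian matrices, and differentiating a trace
  monomial at two positions \<open>a\<close> and \<open>b\<close> multiplies the permutation by \<open>(a b)\<close>. In terms of power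
  sums (\<open>D_star_gap_psum\<close>): \<open>(a b)\<close> splits the cycle containing both, which accounts for
  \<open>D\<^sup>* P\<^sub>k = k \<Sum>\<^bsub>u+v=k-2\<^esub> P\<^sub>u P\<^sub>v\<close>, or merges two cycles, which accounts for the cross terms
  \<open>k l P\<^bsub>k+l-2\<^esub>\<close> of the product rule. So \<open>D\<^sup>* T(p)\<close> is the sum of \<open>T((a b) \<circ> p)\<close> over the ordered
  pairs of distinct fixed points of \<open>p\<close>. An involution \<open>p'\<close> arises in this way once for every
  element of its support (\<open>sum_invols_insert\<close>), each time with the opposite sign. Since
  \<open>E\<^sup>* T(p) = (n - |S|) T(p)\<close>, the contributions of \<open>|S|\<close> cancel in \<open>D\<^sup>* - E\<^sup>*\<close> and the factor \<open>-n\<close>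
  remains (\<open>wick_eigen\<close>).

  The summand of the identity is \<open>n! s\<^sub>\<lambda>\<close> and all others have lower degree, so division by the hook
  product gives a Hermite polynomial. It is the only one: the difference of two has degree
  \<open>d < n\<close>, and since \<open>D\<^sup>*\<close> lowers degrees, its part of degree \<open>d\<close> is multiplied by both \<open>-d\<close> and
  \<open>-n\<close> (\<open>eigen_degree_drop\<close>).
\<close>

section \<open>Polynomial functions and their coordinatewise derivatives\<close>

definition monom_fun :: "nat \<Rightarrow> (nat \<Rightarrow> nat) \<Rightarrow> (nat \<Rightarrow> complex) \<Rightarrow> complex" where
  "monom_fun N m x = (\<Prod>i=1..N. x i ^ m i)"

definition mdeg :: "nat \<Rightarrow> (nat \<Rightarrow> nat) \<Rightarrow> nat" where
  "mdeg N m = (\<Sum>i=1..N. m i)"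

lemma poly_below_iff:
  "poly_below N d f \<longleftrightarrow> (\<exists>M c. finite M \<and> (\<forall>m\<in>M. mdeg N m < d) \<and> f = (\<lambda>x. \<Sum>m\<in>M. c m * monom_fun N m x))"
  unfolding poly_below_def mdeg_def monom_fun_def ..

text \<open>
  The definition of \<open>poly_below\<close> lists each exponent function once. Here different indices may
  share one, which is what sums and products of polynomials produce.
\<close>

lemma poly_below_family:
  assumes "finite I" "\<And>i. i \<in> I \<Longrightarrow> mdeg N (m i) < d"
  shows "poly_below N d (\<lambda>x. \<Sum>i\<in>I. c i * monom_fun N (m i) x)"
proof -
  have "(\<Sum>i\<in>I. c i * monom_fun N (m i) x)
      = (\<Sum>k\<in>m ` I. (\<Sum>i\<in>{i\<in>I. m i = k}. c i) * monom_fun N k x)" for x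
    by (subst sum.image_gen[OF assms(1), of _ m]) (auto simp: sum_distrib_right intro!: sum.cong)
  then show ?thesis
    unfolding poly_below_iff using assms
    by (intro exI[of _ "m ` I"] exI[of _ "\<lambda>k. \<Sum>i\<in>{i\<in>I. m i = k}. c i"]) auto
qed

lemma poly_below_monom:
  assumes "mdeg N m < d"
  shows "poly_below N d (monom_fun N m)"
  unfolding poly_below_iff using assms by (intro exI[of _ "{m}"] exI[of _ "\<lambda>_. 1"]) auto

lemma poly_below_mono: "poly_below N d f \<Longrightarrow> d \<le> e \<Longrightarrow> poly_below N e f"
  unfolding poly_below_def by (elim exE, intro exI conjI; force)

lemma poly_below_0: "poly_below N 0 f \<Longrightarrow> f = (\<lambda>x. 0)"
  unfolding poly_below_def by force

lemma poly_below_sum: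
  assumes "finite J" "\<And>j. j \<in> J \<Longrightarrow> poly_below N d (f j)"
  shows "poly_below N d (\<lambda>x. \<Sum>j\<in>J. w j * f j x)"
proof -
  have "\<forall>j\<in>J. \<exists>M c. finite M \<and> (\<forall>m\<in>M. mdeg N m < d) \<and> f j = (\<lambda>x. \<Sum>m\<in>M. c m * monom_fun N m x)"
    using assms(2) unfolding poly_below_iff by blast
  then obtain M c where M: "\<And>j. j \<in> J \<Longrightarrow> finite (M j)" "\<And>j m. j \<in> J \<Longrightarrow> m \<in> M j \<Longrightarrow> mdeg N m < d"
    and f: "\<And>j. j \<in> J \<Longrightarrow> f j = (\<lambda>x. \<Sum>m\<in>M j. c j m * monom_fun N m x)"
    by metis
  have eq: "(\<lambda>x. \<Sum>j\<in>J. w j * f j x)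
      = (\<lambda>x. \<Sum>p\<in>Sigma J M. (w (fst p) * c (fst p) (snd p)) * monom_fun N (snd p) x)"
    using assms(1) M(1) by (auto simp: f sum_distrib_left sum.Sigma case_prod_beta mult.assoc fun_eq_iff)
  show ?thesis
    unfolding eq by (rule poly_below_family) (use assms(1) M in auto)
qed

lemma poly_below_mult:
  assumes "poly_below N (Suc d) f" "poly_below N (Suc e) g"
  shows "poly_below N (Suc (d + e)) (\<lambda>x. f x * g x)"
proof -
  obtain M c where M: "finite M" "\<And>m. m \<in> M \<Longrightarrow> mdeg N m < Suc d"
    and f: "f = (\<lambda>x. \<Sum>m\<in>M. c m * monom_fun N m x)"
    using assms(1) unfolding poly_below_iff by blast
  obtain M' c' where M': "finite M'" "\<And>m. m \<in> M' \<Longrightarrow> mdeg N m < Suc e"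
    and g: "g = (\<lambda>x. \<Sum>m\<in>M'. c' m * monom_fun N m x)"
    using assms(2) unfolding poly_below_iff by blast
  have mono: "monom_fun N m x * monom_fun N m' x = monom_fun N (\<lambda>i. m i + m' i) x" for m m' x
    by (simp add: monom_fun_def power_add prod.distrib)
  have eq: "(\<lambda>x. f x * g x)
      = (\<lambda>x. \<Sum>p\<in>M \<times> M'. (c (fst p) * c' (snd p)) * monom_fun N (\<lambda>i. fst p i + snd p i) x)"
    unfolding f g fun_eq_iff sum_product sum.cartesian_product mono[symmetric]
    by (auto intro!: sum.cong)
  show ?thesis
    unfolding eq
  proof (rule poly_below_family)
    show "mdeg N (\<lambda>i. fst p i + snd p i) < Suc (d + e)" if "p \<in> M \<times> M'" for p
      using M(2)[of "fst p"] M'(2)[of "snd p"] that by (auto simp: mdeg_def sum.distrib)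
  qed (use M M' in auto)
qed

lemma poly_below_prod:
  assumes "finite C" "\<And>c. c \<in> C \<Longrightarrow> poly_below N (Suc (k c)) (f c)"
  shows "poly_below N (Suc (\<Sum>c\<in>C. k c)) (\<lambda>x. \<Prod>c\<in>C. f c x)"
  using assms
proof (induction C)
  case empty
  have "poly_below N (Suc 0) (\<lambda>x. \<Sum>i\<in>{0::nat}. 1 * monom_fun N (\<lambda>_. 0) x)"
    by (rule poly_below_family) (auto simp: mdeg_def)
  then show ?case by (simp add: monom_fun_def)
next
  case (insert a C)
  then show ?case using poly_below_mult[of N "k a" "f a" "\<Sum>c\<in>C. k c"] by simp
qed

text \<open>
  A derivative in coordinate \<open>i\<close> at every point, so that the operators can be evaluated by
  composing derivative rules instead of unfolding \<open>deriv\<close>.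
\<close>

definition has_pderiv :: "nat \<Rightarrow> ((nat \<Rightarrow> complex) \<Rightarrow> complex) \<Rightarrow> ((nat \<Rightarrow> complex) \<Rightarrow> complex) \<Rightarrow> bool" where
  "has_pderiv i f g \<longleftrightarrow> (\<forall>x t. ((\<lambda>t. f (x(i := t))) has_field_derivative g (x(i := t))) (at t))"

lemma has_pderivD: "has_pderiv i f g \<Longrightarrow> pderiv_at i f = g"
  unfolding has_pderiv_def pderiv_at_def by (intro ext DERIV_imp_deriv) (metis fun_upd_triv)

lemma has_pderiv_sum:
  assumes "\<And>j. j \<in> J \<Longrightarrow> has_pderiv i (f j) (g j)"
  shows "has_pderiv i (\<lambda>x. \<Sum>j\<in>J. w j * f j x) (\<lambda>x. \<Sum>j\<in>J. w j * g j x)"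
  using assms unfolding has_pderiv_def by (auto intro!: DERIV_sum DERIV_cmult)

lemma has_pderiv_cmult: "has_pderiv i f g \<Longrightarrow> has_pderiv i (\<lambda>x. c * f x) (\<lambda>x. c * g x)"
  unfolding has_pderiv_def by (auto intro!: DERIV_cmult)

lemma has_pderiv_prod:
  assumes "\<And>c. c \<in> C \<Longrightarrow> has_pderiv i (f c) (g c)"
  shows "has_pderiv i (\<lambda>x. \<Prod>c\<in>C. f c x) (\<lambda>x. \<Sum>c\<in>C. g c x * (\<Prod>c'\<in>C - {c}. f c' x))"
  using assms unfolding has_pderiv_def by (auto intro!: has_field_derivative_prod)

lemma has_pderiv_mult:
  assumes "has_pderiv i f f'" "has_pderiv i g g'"
  shows "has_pderiv i (\<lambda>x. f x * g x) (\<lambda>x. f' x * g x + f x * g' x)"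
  using assms unfolding has_pderiv_def by (auto intro!: derivative_eq_intros)

lemma has_pderiv_power: "has_pderiv i (\<lambda>x. x i ^ k) (\<lambda>x. of_nat k * x i ^ (k - 1))"
  unfolding has_pderiv_def by (auto intro!: derivative_eq_intros)

lemma monom_fun_upd:
  assumes "i \<in> {1..N}"
  shows "monom_fun N (m(i := k)) (x(i := t)) = t ^ k * (\<Prod>l\<in>{1..N} - {i}. x l ^ m l)"
  unfolding monom_fun_def by (subst prod.remove[OF _ assms]) (auto intro!: prod.cong)

lemma has_pderiv_monom:
  assumes "i \<in> {1..N}"
  shows "has_pderiv i (monom_fun N m) (\<lambda>x. of_nat (m i) * monom_fun N (m(i := m i - 1)) x)"
  unfolding has_pderiv_def
proof (intro allI)
  fix x :: "nat \<Rightarrow> complex" and t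
  have *: "monom_fun N m (x(i := t)) = t ^ m i * (\<Prod>l\<in>{1..N} - {i}. x l ^ m l)" for t
    using monom_fun_upd[OF assms, of m "m i"] by simp
  show "((\<lambda>t. monom_fun N m (x(i := t))) has_field_derivative
      of_nat (m i) * monom_fun N (m(i := m i - 1)) (x(i := t))) (at t)"
    unfolding * monom_fun_upd[OF assms]
    by (auto intro!: derivative_eq_intros)
qed

lemma mdeg_upd_le: "k \<le> m i \<Longrightarrow> mdeg N (m(i := k)) \<le> mdeg N m"
  unfolding mdeg_def by (intro sum_mono) auto

lemma poly_below_has_pderiv:
  assumes "poly_below N d f" "i \<in> {1..N}"
  obtains g where "poly_below N d g" "has_pderiv i f g"
proof -
  obtain M c where M: "finite M" "\<And>m. m \<in> M \<Longrightarrow> mdeg N m < d"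
    and f: "f = (\<lambda>x. \<Sum>m\<in>M. c m * monom_fun N m x)"
    using assms(1) unfolding poly_below_iff by blast
  have 1: "has_pderiv i f (\<lambda>x. \<Sum>m\<in>M. c m * (of_nat (m i) * monom_fun N (m(i := m i - 1)) x))"
    unfolding f by (intro has_pderiv_sum has_pderiv_monom assms)
  have "poly_below N d (\<lambda>x. \<Sum>m\<in>M. (c m * of_nat (m i)) * monom_fun N (m(i := m i - 1)) x)"
    by (rule poly_below_family) (use M le_less_trans[OF mdeg_upd_le] in auto)
  then show ?thesis using 1 that by (simp add: mult.assoc)
qed

lemma pderiv_at_sum:
  assumes "i \<in> {1..N}" "\<And>j. j \<in> J \<Longrightarrow> poly_below N d (f j)"
  shows "pderiv_at i (\<lambda>x. \<Sum>j\<in>J. w j * f j x) = (\<lambda>x. \<Sum>j\<in>J. w j * pderiv_at i (f j) x)"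
proof -
  have "has_pderiv i (f j) (pderiv_at i (f j))" if "j \<in> J" for j
    using poly_below_has_pderiv[OF assms(2)[OF that] assms(1)] has_pderivD by metis
  then show ?thesis by (intro has_pderivD has_pderiv_sum)
qed

lemma poly_below_pderiv_at:
  assumes "poly_below N d f" "i \<in> {1..N}"
  shows "poly_below N d (pderiv_at i f)"
  using poly_below_has_pderiv[OF assms] has_pderivD by metis

lemma E_star_sum:
  assumes "\<And>j. j \<in> J \<Longrightarrow> poly_below N d (f j)"
  shows "E_star N (\<lambda>x. \<Sum>j\<in>J. w j * f j x) x = (\<Sum>j\<in>J. w j * E_star N (f j) x)"
proof -
  have "E_star N (\<lambda>x. \<Sum>j\<in>J. w j * f j x) x = (\<Sum>i=1..N. \<Sum>j\<in>J. w j * (x i * pderiv_at i (f j) x))"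
    unfolding E_star_def
  proof (intro sum.cong refl)
    fix i assume "i \<in> {1..N}"
    then have p: "pderiv_at i (\<lambda>x. \<Sum>j\<in>J. w j * f j x) = (\<lambda>x. \<Sum>j\<in>J. w j * pderiv_at i (f j) x)"
      by (rule pderiv_at_sum[OF _ assms])
    show "x i * pderiv_at i (\<lambda>x. \<Sum>j\<in>J. w j * f j x) x = (\<Sum>j\<in>J. w j * (x i * pderiv_at i (f j) x))"
      unfolding p sum_distrib_left by (simp only: mult.left_commute)
  qed
  also have "\<dots> = (\<Sum>j\<in>J. \<Sum>i=1..N. w j * (x i * pderiv_at i (f j) x))"
    by (rule sum.swap)
  finally show ?thesis
    unfolding E_star_def sum_distrib_left .
qed

lemma D_star_sum:
  assumes "\<And>j. j \<in> J \<Longrightarrow> poly_below N d (f j)"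
  shows "D_star N (\<lambda>x. \<Sum>j\<in>J. w j * f j x) x = (\<Sum>j\<in>J. w j * D_star N (f j) x)"
proof -
  let ?F = "\<lambda>x. \<Sum>j\<in>J. w j * f j x"
  have p: "pderiv_at i ?F = (\<lambda>x. \<Sum>j\<in>J. w j * pderiv_at i (f j) x)" if "i \<in> {1..N}" for i
    by (rule pderiv_at_sum[OF that assms])
  have pp: "pderiv_at i (pderiv_at i ?F) = (\<lambda>x. \<Sum>j\<in>J. w j * pderiv_at i (pderiv_at i (f j)) x)"
    if "i \<in> {1..N}" for i
    unfolding p[OF that] by (rule pderiv_at_sum[OF that poly_below_pderiv_at[OF assms that]])
  have 1: "(\<Sum>i=1..N. pderiv_at i (pderiv_at i ?F) x)
      = (\<Sum>j\<in>J. \<Sum>i=1..N. w j * pderiv_at i (pderiv_at i (f j)) x)"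
    by (rule trans[OF sum.cong[OF refl] sum.swap]) (simp only: pp)
  have "(\<Sum>i=1..N. \<Sum>l\<in>{1..N} - {i}. 1 / (x i - x l) * (pderiv_at i ?F x - pderiv_at l ?F x))
    = (\<Sum>i=1..N. \<Sum>l\<in>{1..N} - {i}. \<Sum>j\<in>J. w j * (1 / (x i - x l) *
          (pderiv_at i (f j) x - pderiv_at l (f j) x)))"
  proof (intro sum.cong refl)
    fix i l assume i: "i \<in> {1..N}" and "l \<in> {1..N} - {i}"
    then have l: "l \<in> {1..N}" by simp
    show "1 / (x i - x l) * (pderiv_at i ?F x - pderiv_at l ?F x)
        = (\<Sum>j\<in>J. w j * (1 / (x i - x l) * (pderiv_at i (f j) x - pderiv_at l (f j) x)))"
      unfolding p[OF i] p[OF l] sum_subtractf[symmetric] sum_distrib_left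
      by (simp only: right_diff_distrib mult.left_commute)
  qed
  also have "\<dots> = (\<Sum>i=1..N. \<Sum>j\<in>J. \<Sum>l\<in>{1..N} - {i}. w j * (1 / (x i - x l) *
          (pderiv_at i (f j) x - pderiv_at l (f j) x)))"
    by (intro sum.cong refl sum.swap)
  also have "\<dots> = (\<Sum>j\<in>J. \<Sum>i=1..N. \<Sum>l\<in>{1..N} - {i}. w j * (1 / (x i - x l) *
          (pderiv_at i (f j) x - pderiv_at l (f j) x)))"
    by (rule sum.swap)
  finally show ?thesis
    unfolding D_star_def 1 by (simp only: sum_distrib_left distrib_left sum.distrib)
qed

lemma monom_fun_scale: "monom_fun N m (\<lambda>i. t * x i) = t ^ mdeg N m * monom_fun N m x"
  by (simp add: monom_fun_def mdeg_def power_mult_distrib prod.distrib power_sum)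

lemma monom_fun_lower_scale:
  assumes "i \<in> {1..N}" "k \<le> m i"
  shows "t ^ k * monom_fun N (m(i := m i - k)) (\<lambda>i. t * x i)
       = t ^ mdeg N m * monom_fun N (m(i := m i - k)) x"
proof -
  have "mdeg N (m(i := m i - k)) = m i - k + (\<Sum>l\<in>{1..N} - {i}. m l)"
    unfolding mdeg_def by (subst sum.remove[OF _ assms(1)]) (auto intro!: sum.cong)
  moreover have "mdeg N m = m i + (\<Sum>l\<in>{1..N} - {i}. m l)"
    unfolding mdeg_def by (subst sum.remove[OF _ assms(1)]) auto
  ultimately have "mdeg N m = k + mdeg N (m(i := m i - k))" using assms by simp
  then show ?thesis by (simp add: monom_fun_scale power_add)
qed

lemma E_star_monom: "E_star N (monom_fun N m) x = of_nat (mdeg N m) * monom_fun N m x"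
proof -
  have "x i * pderiv_at i (monom_fun N m) x = of_nat (m i) * monom_fun N m x" if "i \<in> {1..N}" for i
  proof (cases "m i")
    case 0
    then show ?thesis by (simp add: has_pderivD[OF has_pderiv_monom[OF that]])
  next
    case (Suc k)
    then show ?thesis
      using monom_fun_upd[OF that, of m "m i - 1" x "x i"]
        monom_fun_upd[OF that, of m "m i" x "x i", unfolded fun_upd_triv]
      by (simp add: has_pderivD[OF has_pderiv_monom[OF that]])
  qed
  then have "E_star N (monom_fun N m) x = (\<Sum>i=1..N. of_nat (m i) * monom_fun N m x)"
    unfolding E_star_def by (intro sum.cong) auto
  then show ?thesis by (simp add: mdeg_def sum_distrib_right)
qed

text \<open>
  The rational part of \<open>D\<^sup>*\<close> need not be a polynomial on a single monomial. Homogeneity of degree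
  \<open>-2\<close> along rays through the origin replaces that.
\<close>

lemma D_star_monom_scale:
  assumes "t \<noteq> 0"
  shows "t\<^sup>2 * D_star N (monom_fun N m) (\<lambda>i. t * x i) = t ^ mdeg N m * D_star N (monom_fun N m) x"
proof -
  let ?f = "monom_fun N m" and ?y = "\<lambda>i. t * x i"
  have 1: "t * pderiv_at i ?f ?y = t ^ mdeg N m * pderiv_at i ?f x" if "i \<in> {1..N}" for i
  proof (cases "m i = 0")
    case True
    then show ?thesis by (simp add: has_pderivD[OF has_pderiv_monom[OF that]])
  next
    case False
    then show ?thesis using monom_fun_lower_scale[OF that, of 1 m t x]
      by (simp add: has_pderivD[OF has_pderiv_monom[OF that]])
  qed
  have pp: "pderiv_at i (pderiv_at i ?f) = (\<lambda>x. of_nat (m i) * (of_nat (m i - 1) * monom_fun N (m(i := m i - 2)) x))"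
    if "i \<in> {1..N}" for i
  proof -
    have "has_pderiv i (\<lambda>x. of_nat (m i) * monom_fun N (m(i := m i - 1)) x)
        (\<lambda>x. of_nat (m i) * (of_nat (m i - 1) * monom_fun N (m(i := m i - 2)) x))"
      using has_pderiv_cmult[OF has_pderiv_monom[OF that, of "m(i := m i - 1)"]]
      by (simp add: diff_diff_left numeral_2_eq_2)
    then show ?thesis
      unfolding has_pderivD[OF has_pderiv_monom[OF that]] by (rule has_pderivD)
  qed
  have 2: "t\<^sup>2 * pderiv_at i (pderiv_at i ?f) ?y = t ^ mdeg N m * pderiv_at i (pderiv_at i ?f) x"
    if "i \<in> {1..N}" for i
  proof (cases "m i < 2")
    case True
    then have "m i = 0 \<or> m i - 1 = 0" by linarith
    then show ?thesis unfolding pp[OF that] by auto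
  next
    case False
    then show ?thesis using monom_fun_lower_scale[OF that, of 2 m t x]
      by (simp add: pp[OF that])
  qed
  have 3: "t\<^sup>2 * (1 / (?y i - ?y j) * (pderiv_at i ?f ?y - pderiv_at j ?f ?y))
      = t ^ mdeg N m * (1 / (x i - x j) * (pderiv_at i ?f x - pderiv_at j ?f x))"
    if "i \<in> {1..N}" "j \<in> {1..N}" for i j
  proof -
    have "t\<^sup>2 * (1 / (?y i - ?y j) * (pderiv_at i ?f ?y - pderiv_at j ?f ?y))
        = 1 / (x i - x j) * (t * pderiv_at i ?f ?y - t * pderiv_at j ?f ?y)"
      using assms unfolding right_diff_distrib[symmetric] by (simp add: power2_eq_square)
    then show ?thesis using 1[OF that(1)] 1[OF that(2)] by (simp add: algebra_simps)
  qed
  show ?thesis unfolding D_star_def distrib_left sum_distrib_left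
    by (intro arg_cong2[where f="(+)"] sum.cong refl 2 3) auto
qed

text \<open>
  Points with distinct coordinates are dense: in the direction \<open>(1, 2, 3, \<dots>)\<close> only finitely many
  points of a line have two equal coordinates.
\<close>

lemma poly_below_zero_of_inj:
  assumes "poly_below N d f" "\<And>x. inj_on x {1..N} \<Longrightarrow> f x = 0"
  shows "f x = 0"
proof -
  let ?y = "\<lambda>t i. x i + t * of_nat i"
  let ?B = "(\<lambda>(i, j). (x i - x j) / (of_nat j - of_nat i)) ` ({1..N} \<times> {1..N}) - {0}"
  obtain M c where f: "f = (\<lambda>x. \<Sum>m\<in>M. c m * monom_fun N m x)"
    using assms(1) unfolding poly_below_iff by blast
  have "continuous_on UNIV (\<lambda>t. f (?y t))"
    unfolding f monom_fun_def by (intro continuous_intros)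
  then have lim: "(\<lambda>t. f (?y t)) \<midarrow>0\<rightarrow> f (?y 0)"
    by (intro isContD) (simp add: continuous_on_eq_continuous_at)
  have fin: "finite ?B" by (intro finite_Diff finite_imageI finite_cartesian_product) auto
  have "inj_on (?y t) {1..N}" if "t \<noteq> 0" "t \<notin> ?B" for t
  proof (rule inj_onI, rule ccontr)
    fix i j assume ij: "i \<in> {1..N}" "j \<in> {1..N}" "?y t i = ?y t j" "i \<noteq> j"
    then have "t = (x i - x j) / (of_nat j - of_nat i)"
      by (auto simp: field_simps)
    then show False using that ij by auto
  qed
  then have z: "f (?y t) = 0" if "t \<noteq> 0" "t \<notin> ?B" for t
    using assms(2) that by blast
  have "eventually (\<lambda>t. t \<in> - ?B) (nhds 0)"
    by (intro eventually_nhds_in_open open_Compl finite_imp_closed fin) simp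
  then have "eventually (\<lambda>t. f (?y t) = 0) (at 0)"
    unfolding eventually_at_filter by eventually_elim (use z in auto)
  then have "(\<lambda>t. f (?y t)) \<midarrow>0\<rightarrow> 0"
    by (rule tendsto_eventually)
  then have "f (?y 0) = 0" using lim LIM_unique by blast
  then show ?thesis by simp
qed

section \<open>Uniqueness: an eigenfunction of low degree vanishes\<close>

text \<open>
  On the ray through a point with distinct coordinates, \<open>t\<^sup>2\<close> times the equation is a polynomial
  identity in \<open>t\<close>. Its coefficient at \<open>t\<^bsup>d+2\<^esup>\<close> comes from the top-degree monomials alone,
  because \<open>D\<^sup>*\<close> contributes only up to \<open>t\<^sup>d\<close>, and it equals \<open>n - d\<close> times the top-degree part.
\<close>

lemma eigen_degree_drop:
  assumes "poly_below N (Suc d) G" "d < n"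
    and eig: "\<And>x. inj_on x {1..N} \<Longrightarrow> D_star N G x - E_star N G x = - of_nat n * G x"
  shows "poly_below N d G"
proof -
  obtain M c where M: "finite M" "\<And>m. m \<in> M \<Longrightarrow> mdeg N m < Suc d"
    and G: "G = (\<lambda>x. \<Sum>m\<in>M. c m * monom_fun N m x)"
    using assms(1) unfolding poly_below_iff by blast
  have pb: "poly_below N (Suc d) (monom_fun N m)" if "m \<in> M" for m
    by (rule poly_below_monom[OF M(2)[OF that]])
  have DG: "D_star N G y = (\<Sum>m\<in>M. c m * D_star N (monom_fun N m) y)" for y
    unfolding G by (rule D_star_sum[OF pb])
  have EG: "E_star N G y = (\<Sum>m\<in>M. c m * E_star N (monom_fun N m) y)" for y
    unfolding G by (rule E_star_sum[OF pb])
  let ?T = "{m\<in>M. mdeg N m = d}"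
  let ?top = "\<lambda>x. \<Sum>m\<in>?T. c m * monom_fun N m x"
  have top: "?top x = 0" if inj: "inj_on x {1..N}" for x
  proof -
    \<comment> \<open>\<open>t\<^sup>2\<close> times the equation on the ray through \<open>x\<close>, as a polynomial in \<open>t\<close>\<close>
    define p where "p = (\<Sum>m\<in>M. monom (c m * D_star N (monom_fun N m) x) (mdeg N m)
        + monom (c m * (of_nat n - of_nat (mdeg N m)) * monom_fun N m x) (mdeg N m + 2))"
    have "poly p t = 0" if t: "t \<noteq> 0" for t
    proof -
      let ?y = "\<lambda>i. t * x i"
      have "inj_on ?y {1..N}" using inj unfolding inj_on_def mult_left_cancel[OF t] .
      then have e: "D_star N G ?y - E_star N G ?y = - of_nat n * G ?y" by (rule eig)
      have "0 = t\<^sup>2 * (D_star N G ?y - E_star N G ?y + of_nat n * G ?y)"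
        unfolding e by simp
      also have "\<dots> = (\<Sum>m\<in>M. t\<^sup>2 * (c m * D_star N (monom_fun N m) ?y
          - c m * E_star N (monom_fun N m) ?y + of_nat n * (c m * monom_fun N m ?y)))"
        unfolding DG EG unfolding G
        by (simp add: sum_distrib_left sum.distrib sum_subtractf distrib_left right_diff_distrib)
      also have "\<dots> = (\<Sum>m\<in>M. c m * (t\<^sup>2 * D_star N (monom_fun N m) ?y)
          + t\<^sup>2 * (c m * (of_nat n - of_nat (mdeg N m)) * monom_fun N m ?y))"
        by (simp add: E_star_monom algebra_simps)
      also have "\<dots> = poly p t"
        unfolding p_def D_star_monom_scale[OF t] poly_sum
        by (intro sum.cong) (auto simp: poly_monom monom_fun_scale power_add power2_eq_square)
      finally show ?thesis by simp
    qed
    then have "UNIV - {0} \<subseteq> {t. poly p t = 0}" by auto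
    moreover have "infinite (UNIV - {0 :: complex})"
      using infinite_UNIV_char_0 by (metis finite.emptyI finite_Diff_insert Diff_empty)
    ultimately have "p = 0" using poly_roots_finite finite_subset by blast
    then have "0 = coeff p (d + 2)" by simp
    also have "\<dots> = (\<Sum>m\<in>M. if mdeg N m = d then c m * (of_nat n - of_nat d) * monom_fun N m x else 0)"
      unfolding p_def coeff_sum by (intro sum.cong) (use M(2) in \<open>force+\<close>)
    also have "\<dots> = (\<Sum>m\<in>?T. c m * (of_nat n - of_nat d) * monom_fun N m x)"
      by (rule sum.inter_filter[OF M(1), symmetric])
    also have "\<dots> = (of_nat n - of_nat d) * ?top x"
      by (simp only: sum_distrib_left mult_ac)
    finally show ?thesis using assms(2) by simp
  qed
  have "poly_below N (Suc d) ?top"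
    using M by (intro poly_below_sum pb) auto
  then have "?top x = 0" for x using poly_below_zero_of_inj top by blast
  moreover have "G x = ?top x + (\<Sum>m\<in>M - ?T. c m * monom_fun N m x)" for x
    unfolding G using M(1) by (subst sum.subset_diff[of ?T]) auto
  ultimately have "G = (\<lambda>x. \<Sum>m\<in>M - ?T. c m * monom_fun N m x)" by auto
  moreover have "mdeg N m < d" if "m \<in> M - ?T" for m using M(2)[of m] that by auto
  ultimately show ?thesis using M(1) poly_below_family[of "M - ?T" N "\<lambda>m. m" d c] by simp
qed

lemma eigen_low_degree_zero:
  assumes "poly_below N d G" "d \<le> n"
    and "\<And>x. inj_on x {1..N} \<Longrightarrow> D_star N G x - E_star N G x = - of_nat n * G x"
  shows "G = (\<lambda>x. 0)"
  using assms(1,2)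
proof (induction d)
  case 0
  then show ?case by (simp add: poly_below_0)
next
  case (Suc d)
  then show ?case using eigen_degree_drop[OF Suc.prems(1) _ assms(3)] by simp
qed

lemma is_hermite_unique:
  assumes "is_hermite N n lam H" "is_hermite N n lam H'"
  shows "H = H'"
proof -
  \<comment> \<open>the difference \<open>H - H'\<close> as a sum over two indices, to which the linearity lemmas apply\<close>
  let ?w = "\<lambda>j::bool. if j then 1 else - 1 :: complex" and ?f = "\<lambda>j. if j then H else H'"
  let ?G = "\<lambda>x. \<Sum>j\<in>UNIV. ?w j * ?f j x"
  let ?s = "\<lambda>x. fact n / of_nat (hook_prod lam) * schur N n lam x"
  have "poly_below N n (\<lambda>x. \<Sum>j\<in>UNIV. ?w j * ((\<lambda>x. ?f j x - ?s x)) x)"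
    by (rule poly_below_sum) (use assms in \<open>auto simp: is_hermite_def\<close>)
  then have low: "poly_below N n ?G" by (simp add: UNIV_bool)
  obtain d1 d2 where "poly_below N d1 H" "poly_below N d2 H'"
    using assms unfolding is_hermite_def sym_poly_def by blast
  then have pb: "poly_below N (max d1 d2) (?f j)" for j
    by (auto intro: poly_below_mono)
  have "?G = (\<lambda>x. 0)"
  proof (rule eigen_low_degree_zero[OF low order_refl])
    fix x :: "nat \<Rightarrow> complex" assume "inj_on x {1..N}"
    then have "D_star N H x - E_star N H x = - of_nat n * H x"
        "D_star N H' x - E_star N H' x = - of_nat n * H' x"
      using assms unfolding is_hermite_def by blast+
    then have "E_star N H x = D_star N H x + of_nat n * H x"
        "E_star N H' x = D_star N H' x + of_nat n * H' x"
      by (simp_all add: algebra_simps)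
    then show "D_star N ?G x - E_star N ?G x = - of_nat n * ?G x"
      unfolding D_star_sum[OF pb] E_star_sum[OF pb] by (simp add: UNIV_bool algebra_simps)
  qed
  then show ?thesis by (simp add: UNIV_bool fun_eq_iff)
qed

section \<open>The operators on products of power sums\<close>

definition power_sum :: "nat \<Rightarrow> nat \<Rightarrow> (nat \<Rightarrow> complex) \<Rightarrow> complex" where
  "power_sum N k x = (\<Sum>i=1..N. x i ^ k)"

lemma has_pderiv_power_sum:
  assumes "i \<in> {1..N}"
  shows "has_pderiv i (power_sum N k) (\<lambda>x. of_nat k * x i ^ (k - 1))"
proof -
  have "power_sum N k (x(i := t)) = t ^ k + (\<Sum>j\<in>{1..N} - {i}. x j ^ k)" for x t
    unfolding power_sum_def by (subst sum.remove[OF _ assms]) auto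
  then show ?thesis
    unfolding has_pderiv_def by (auto intro!: derivative_eq_intros)
qed

lemma sum_split_diagonal:
  fixes f :: "nat \<Rightarrow> nat \<Rightarrow> complex"
  shows "(\<Sum>i=1..N. \<Sum>j=1..N. f i j) = (\<Sum>i=1..N. f i i) + (\<Sum>i=1..N. \<Sum>j\<in>{1..N} - {i}. f i j)"
  unfolding sum.distrib[symmetric] by (intro sum.cong refl sum.remove) auto

text \<open>
  The case of one power sum. The divided differences \<open>(x\<^sub>i\<^bsup>k-1\<^esup> - x\<^sub>j\<^bsup>k-1\<^esup>) / (x\<^sub>i - x\<^sub>j)\<close> give the
  off-diagonal terms of \<open>P\<^sub>u P\<^sub>v\<close>, and the second derivatives give the diagonal ones.
\<close>

lemma D_star_single_power_sum:
  assumes "inj_on x {1..N}"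
  shows "(\<Sum>i=1..N. of_nat k * (of_nat (k - 1) * x i ^ (k - 1 - 1)))
     + (\<Sum>i=1..N. \<Sum>j\<in>{1..N} - {i}. 1 / (x i - x j) * (of_nat k * x i ^ (k - 1) - of_nat k * x j ^ (k - 1)))
     = of_nat k * (\<Sum>u<k - 1. power_sum N u x * power_sum N (k - 2 - u) x)"
proof (cases "k < 2")
  case True
  then have "k = 0 \<or> k = 1" by linarith
  then show ?thesis by auto
next
  case False
  then obtain m where k: "k = Suc (Suc m)"
    by (metis One_nat_def Suc_1 add_2_eq_Suc le_add_diff_inverse not_less)
  then have k1: "k - 1 = Suc m" and k2: "Suc m - 1 = m" by simp_all
  let ?g = "\<lambda>i j. \<Sum>u<Suc m. x i ^ u * x j ^ (m - u)"
  have diag: "of_nat (Suc m) * x i ^ m = ?g i i" for i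
  proof -
    have "?g i i = (\<Sum>u<Suc m. x i ^ m)"
      by (intro sum.cong refl) (simp add: power_add[symmetric])
    then show ?thesis by (simp only: sum_constant card_lessThan)
  qed
  have off: "1 / (x i - x j) * (of_nat k * x i ^ Suc m - of_nat k * x j ^ Suc m) = of_nat k * ?g i j"
    if "i \<in> {1..N}" "j \<in> {1..N} - {i}" for i j
  proof -
    have "x i \<noteq> x j" using assms that unfolding inj_on_def by blast
    then show ?thesis unfolding right_diff_distrib[symmetric] diff_power_eq_sum
      by simp
  qed
  have "(\<Sum>u<k - 1. power_sum N u x * power_sum N (k - 2 - u) x) = (\<Sum>u<Suc m. \<Sum>i=1..N. \<Sum>j=1..N. x i ^ u * x j ^ (m - u))"
    unfolding power_sum_def sum_product k by simp
  also have "\<dots> = (\<Sum>i=1..N. \<Sum>u<Suc m. \<Sum>j=1..N. x i ^ u * x j ^ (m - u))"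
    by (rule sum.swap)
  also have "\<dots> = (\<Sum>i=1..N. \<Sum>j=1..N. ?g i j)"
    by (intro sum.cong refl sum.swap)
  finally have prod: "(\<Sum>u<k - 1. power_sum N u x * power_sum N (k - 2 - u) x) = (\<Sum>i=1..N. \<Sum>j=1..N. ?g i j)" .
  have "of_nat k * (\<Sum>u<k - 1. power_sum N u x * power_sum N (k - 2 - u) x)
      = (\<Sum>i=1..N. of_nat k * ?g i i) + (\<Sum>i=1..N. \<Sum>j\<in>{1..N} - {i}. of_nat k * ?g i j)"
    unfolding prod sum_split_diagonal by (simp only: distrib_left sum_distrib_left)
  also have "\<dots> = (\<Sum>i=1..N. of_nat k * (of_nat (k - 1) * x i ^ (k - 1 - 1)))
     + (\<Sum>i=1..N. \<Sum>j\<in>{1..N} - {i}. 1 / (x i - x j) * (of_nat k * x i ^ (k - 1) - of_nat k * x j ^ (k - 1)))"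
  proof (rule arg_cong2[where f="(+)"])
    show "(\<Sum>i=1..N. of_nat k * ?g i i) = (\<Sum>i=1..N. of_nat k * (of_nat (k - 1) * x i ^ (k - 1 - 1)))"
      unfolding k1 k2 diag ..
    show "(\<Sum>i=1..N. \<Sum>j\<in>{1..N} - {i}. of_nat k * ?g i j)
      = (\<Sum>i=1..N. \<Sum>j\<in>{1..N} - {i}. 1 / (x i - x j) * (of_nat k * x i ^ (k - 1) - of_nat k * x j ^ (k - 1)))"
      unfolding k1 by (rule sum.cong[OF refl], rule sum.cong[OF refl], rule off[symmetric])
  qed
  finally show ?thesis by (rule sym)
qed

lemma pderiv_at_prod_power_sum:
  assumes "i \<in> {1..N}"
  shows "pderiv_at i (\<lambda>x. \<Prod>c\<in>C. power_sum N (k c) x)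
    = (\<lambda>x. \<Sum>c\<in>C. of_nat (k c) * x i ^ (k c - 1) * (\<Prod>d\<in>C - {c}. power_sum N (k d) x))"
  by (intro has_pderivD has_pderiv_prod has_pderiv_power_sum assms)

lemma pderiv_at2_prod_power_sum:
  assumes "i \<in> {1..N}"
  shows "pderiv_at i (pderiv_at i (\<lambda>x. \<Prod>c\<in>C. power_sum N (k c) x))
    = (\<lambda>x. \<Sum>c\<in>C. of_nat (k c) * (of_nat (k c - 1) * x i ^ (k c - 1 - 1)) * (\<Prod>d\<in>C - {c}. power_sum N (k d) x)
         + of_nat (k c) * x i ^ (k c - 1) * (\<Sum>d\<in>C - {c}. of_nat (k d) * x i ^ (k d - 1) * (\<Prod>e\<in>C - {c} - {d}. power_sum N (k e) x)))"
proof -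
  have "has_pderiv i (\<lambda>x. \<Sum>c\<in>C. 1 * (of_nat (k c) * x i ^ (k c - 1) * (\<Prod>d\<in>C - {c}. power_sum N (k d) x)))
     (\<lambda>x. \<Sum>c\<in>C. 1 * (of_nat (k c) * (of_nat (k c - 1) * x i ^ (k c - 1 - 1)) * (\<Prod>d\<in>C - {c}. power_sum N (k d) x)
         + of_nat (k c) * x i ^ (k c - 1) * (\<Sum>d\<in>C - {c}. of_nat (k d) * x i ^ (k d - 1) * (\<Prod>e\<in>C - {c} - {d}. power_sum N (k e) x))))"
    by (intro has_pderiv_sum has_pderiv_mult has_pderiv_cmult has_pderiv_power has_pderiv_prod
        has_pderiv_power_sum assms)
  then show ?thesis
    unfolding pderiv_at_prod_power_sum[OF assms] mult_1 by (rule has_pderivD)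
qed

lemma E_star_prod_power_sum:
  assumes "finite C"
  shows "E_star N (\<lambda>x. \<Prod>c\<in>C. power_sum N (k c) x) x
    = of_nat (\<Sum>c\<in>C. k c) * (\<Prod>c\<in>C. power_sum N (k c) x)"
proof -
  have pw: "x i * (of_nat l * x i ^ (l - 1)) = of_nat l * x i ^ l" for i l by (cases l) auto
  have "E_star N (\<lambda>x. \<Prod>c\<in>C. power_sum N (k c) x) x
      = (\<Sum>i=1..N. \<Sum>c\<in>C. of_nat (k c) * x i ^ k c * (\<Prod>d\<in>C - {c}. power_sum N (k d) x))"
    unfolding E_star_def
  proof (intro sum.cong refl)
    fix i assume i: "i \<in> {1..N}"
    show "x i * pderiv_at i (\<lambda>x. \<Prod>c\<in>C. power_sum N (k c) x) x
      = (\<Sum>c\<in>C. of_nat (k c) * x i ^ k c * (\<Prod>d\<in>C - {c}. power_sum N (k d) x))"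
      unfolding pderiv_at_prod_power_sum[OF i] sum_distrib_left
      by (intro sum.cong refl) (simp only: mult.assoc[symmetric] pw[unfolded mult.assoc[symmetric]])
  qed
  also have "\<dots> = (\<Sum>c\<in>C. \<Sum>i=1..N. of_nat (k c) * x i ^ k c * (\<Prod>d\<in>C - {c}. power_sum N (k d) x))"
    by (rule sum.swap)
  also have "\<dots> = (\<Sum>c\<in>C. of_nat (k c) * (power_sum N (k c) x * (\<Prod>d\<in>C - {c}. power_sum N (k d) x)))"
    by (simp only: power_sum_def sum_distrib_left sum_distrib_right mult.assoc)
  also have "\<dots> = (\<Sum>c\<in>C. of_nat (k c) * (\<Prod>c\<in>C. power_sum N (k c) x))"
  proof (intro sum.cong refl)
    fix c assume "c \<in> C"
    then show "of_nat (k c) * (power_sum N (k c) x * (\<Prod>d\<in>C - {c}. power_sum N (k d) x))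
        = of_nat (k c) * (\<Prod>c\<in>C. power_sum N (k c) x)"
      by (subst prod.remove[OF assms, of c]) simp_all
  qed
  finally show ?thesis by (simp add: sum_distrib_right)
qed

lemma D_star_prod_power_sum:
  assumes inj: "inj_on x {1..N}"
  shows "D_star N (\<lambda>x. \<Prod>c\<in>C. power_sum N (k c) x) x
    = (\<Sum>c\<in>C. of_nat (k c) * (\<Sum>u<k c - 1. power_sum N u x * power_sum N (k c - 2 - u) x)
          * (\<Prod>d\<in>C - {c}. power_sum N (k d) x))
    + (\<Sum>c\<in>C. \<Sum>d\<in>C - {c}. of_nat (k c) * of_nat (k d) * power_sum N (k c + k d - 2) x
          * (\<Prod>e\<in>C - {c} - {d}. power_sum N (k e) x))"
proof -
  let ?F = "\<lambda>x. \<Prod>c\<in>C. power_sum N (k c) x"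
  let ?R = "\<lambda>c. \<Prod>d\<in>C - {c}. power_sum N (k d) x"
  let ?Q = "\<lambda>c d. \<Prod>e\<in>C - {c} - {d}. power_sum N (k e) x"
  let ?d = "\<lambda>c i. of_nat (k c) * x i ^ (k c - 1)"
  let ?dd = "\<lambda>c i. of_nat (k c) * (of_nat (k c - 1) * x i ^ (k c - 1 - 1))"
  have "(\<Sum>i=1..N. pderiv_at i (pderiv_at i ?F) x)
      = (\<Sum>i=1..N. (\<Sum>c\<in>C. ?dd c i * ?R c) + (\<Sum>c\<in>C. \<Sum>d\<in>C - {c}. ?d c i * ?d d i * ?Q c d))"
    by (intro sum.cong refl) (simp only: pderiv_at2_prod_power_sum sum.distrib sum_distrib_left mult.assoc)
  also have "\<dots> = (\<Sum>i=1..N. \<Sum>c\<in>C. ?dd c i * ?R c) + (\<Sum>i=1..N. \<Sum>c\<in>C. \<Sum>d\<in>C - {c}. ?d c i * ?d d i * ?Q c d)"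
    by (rule sum.distrib)
  also have "(\<Sum>i=1..N. \<Sum>c\<in>C. ?dd c i * ?R c) = (\<Sum>c\<in>C. (\<Sum>i=1..N. ?dd c i) * ?R c)"
    unfolding sum_distrib_right by (rule sum.swap)
  also have "(\<Sum>i=1..N. \<Sum>c\<in>C. \<Sum>d\<in>C - {c}. ?d c i * ?d d i * ?Q c d)
      = (\<Sum>c\<in>C. \<Sum>i=1..N. \<Sum>d\<in>C - {c}. ?d c i * ?d d i * ?Q c d)"
    by (rule sum.swap)
  also have "\<dots> = (\<Sum>c\<in>C. \<Sum>d\<in>C - {c}. (\<Sum>i=1..N. ?d c i * ?d d i) * ?Q c d)"
    unfolding sum_distrib_right by (intro sum.cong refl sum.swap)
  finally have second: "(\<Sum>i=1..N. pderiv_at i (pderiv_at i ?F) x)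
      = (\<Sum>c\<in>C. (\<Sum>i=1..N. ?dd c i) * ?R c)
      + (\<Sum>c\<in>C. \<Sum>d\<in>C - {c}. (\<Sum>i=1..N. ?d c i * ?d d i) * ?Q c d)" .
  have cross: "(\<Sum>i=1..N. ?d c i * ?d d i) = of_nat (k c) * of_nat (k d) * power_sum N (k c + k d - 2) x" for c d
  proof (cases "k c = 0 \<or> k d = 0")
    case False
    then have "k c - 1 + (k d - 1) = k c + k d - 2" by linarith
    then have "?d c i * ?d d i = of_nat (k c) * of_nat (k d) * x i ^ (k c + k d - 2)" for i
      by (metis (no_types, lifting) mult.assoc mult.left_commute power_add)
    then show ?thesis by (simp only: power_sum_def sum_distrib_left)
  qed auto
  have "(\<Sum>i=1..N. \<Sum>j\<in>{1..N} - {i}. 1 / (x i - x j) * (pderiv_at i ?F x - pderiv_at j ?F x))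
      = (\<Sum>i=1..N. \<Sum>j\<in>{1..N} - {i}. \<Sum>c\<in>C. 1 / (x i - x j) * (?d c i - ?d c j) * ?R c)"
  proof (intro sum.cong refl)
    fix i j assume i: "i \<in> {1..N}" and "j \<in> {1..N} - {i}"
    then have j: "j \<in> {1..N}" by simp
    show "1 / (x i - x j) * (pderiv_at i ?F x - pderiv_at j ?F x)
        = (\<Sum>c\<in>C. 1 / (x i - x j) * (?d c i - ?d c j) * ?R c)"
      unfolding pderiv_at_prod_power_sum[OF i] pderiv_at_prod_power_sum[OF j] sum_subtractf[symmetric]
        sum_distrib_left left_diff_distrib[symmetric] mult.assoc[symmetric] ..
  qed
  also have "\<dots> = (\<Sum>i=1..N. \<Sum>c\<in>C. \<Sum>j\<in>{1..N} - {i}. 1 / (x i - x j) * (?d c i - ?d c j) * ?R c)"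
    by (intro sum.cong refl sum.swap)
  also have "\<dots> = (\<Sum>c\<in>C. \<Sum>i=1..N. \<Sum>j\<in>{1..N} - {i}. 1 / (x i - x j) * (?d c i - ?d c j) * ?R c)"
    by (rule sum.swap)
  also have "\<dots> = (\<Sum>c\<in>C. (\<Sum>i=1..N. \<Sum>j\<in>{1..N} - {i}. 1 / (x i - x j) * (?d c i - ?d c j)) * ?R c)"
    by (simp only: sum_distrib_right)
  finally show ?thesis
    unfolding D_star_def second cross D_star_single_power_sum[OF inj, symmetric]
    by (simp only: distrib_right sum.distrib add_ac)
qed

lemma poly_below_power_sum: "poly_below N (Suc k) (power_sum N k)"
proof -
  have m: "monom_fun N (\<lambda>j. if j = i then k else 0) x = x i ^ k"
    and d: "mdeg N (\<lambda>j. if j = i then k else 0) = k" if "i \<in> {1..N}" for i x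
  proof -
    have "monom_fun N (\<lambda>j. if j = i then k else 0) x = (\<Prod>j=1..N. if j = i then x j ^ k else 1)"
      unfolding monom_fun_def by (intro prod.cong) auto
    then show "monom_fun N (\<lambda>j. if j = i then k else 0) x = x i ^ k" using that by simp
    show "mdeg N (\<lambda>j. if j = i then k else 0) = k" using that by (simp add: mdeg_def)
  qed
  have "poly_below N (Suc k) (\<lambda>x. \<Sum>i\<in>{1..N}. 1 * monom_fun N (\<lambda>j. if j = i then k else 0) x)"
    by (rule poly_below_family) (use d in auto)
  moreover have "(\<lambda>x. \<Sum>i\<in>{1..N}. 1 * monom_fun N (\<lambda>j. if j = i then k else 0) x) = power_sum N k"
    unfolding power_sum_def by (intro ext sum.cong refl) (simp only: m mult_1)
  ultimately show ?thesis by simp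
qed

lemma power_sum_permute:
  assumes "\<sigma> permutes {1..N}"
  shows "power_sum N k (x \<circ> \<sigma>) = power_sum N k x"
  unfolding power_sum_def using sum.permute[OF assms, of "\<lambda>i. x i ^ k"] by (simp add: o_def)

section \<open>Cycles of a permutation after composition with a transposition\<close>

text \<open>
  Cutting a cycle at \<open>a\<close> and at a varying second element leaves first pieces of every possible size
  exactly once.
\<close>

lemma sum_over_ranks:
  fixes g :: "nat \<Rightarrow> 'a::comm_monoid_add" and A :: "'b::linorder set"
  assumes "finite A"
  shows "(\<Sum>t\<in>A. g (card {s\<in>A. s < t})) = (\<Sum>u<card A. g u)"
  using assms
proof (induction A rule: finite_linorder_max_induct)
  case empty
  then show ?case by simp
next
  case (insert b A)
  have "b \<notin> A" using insert by auto
  have "{s \<in> insert b A. s < t} = {s \<in> A. s < t}" if "t \<in> A" for t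
    using insert.hyps(2) that by auto
  moreover have "{s \<in> insert b A. s < b} = A" using insert.hyps(2) by auto
  ultimately show ?case
    using \<open>b \<notin> A\<close> insert by (simp add: add.commute)
qed

text \<open>
  Until an orbit of \<open>\<sigma>\<close> hits \<open>a\<close> or \<open>b\<close>, the transposition is not seen. Both the splitting and the
  merging of cycles follow from this.
\<close>

lemma transpose_iterate:
  fixes \<sigma> :: "'a \<Rightarrow> 'a"
  assumes "\<And>s. 0 < s \<Longrightarrow> s < k \<Longrightarrow> (\<sigma> ^^ s) x \<notin> {a, b}"
  shows "s < k \<Longrightarrow> ((Transposition.transpose a b \<circ> \<sigma>) ^^ s) x = (\<sigma> ^^ s) x"
    and "0 < k \<Longrightarrow> ((Transposition.transpose a b \<circ> \<sigma>) ^^ k) x = Transposition.transpose a b ((\<sigma> ^^ k) x)"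
proof -
  have *: "((Transposition.transpose a b \<circ> \<sigma>) ^^ s) x = (\<sigma> ^^ s) x" if "s < k" for s
    using that
  proof (induction s)
    case (Suc s)
    then show ?case using assms[of "Suc s"] by simp
  qed simp
  then show "s < k \<Longrightarrow> ((Transposition.transpose a b \<circ> \<sigma>) ^^ s) x = (\<sigma> ^^ s) x" .
  assume "0 < k"
  then obtain l where "k = Suc l" using gr0_conv_Suc by blast
  then show "((Transposition.transpose a b \<circ> \<sigma>) ^^ k) x = Transposition.transpose a b ((\<sigma> ^^ k) x)"
    using *[of l] by simp
qed

lemma self_orbit_period:
  assumes "a \<in> orbit \<sigma> a"
  obtains m where "0 < m" "(\<sigma> ^^ m) a = a" "inj_on (\<lambda>s. (\<sigma> ^^ s) a) {..<m}"
    "orbit \<sigma> a = (\<lambda>s. (\<sigma> ^^ s) a) ` {..<m}"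
proof (rule that)
  let ?m = "funpow_dist1 \<sigma> a a"
  show "0 < ?m" by simp
  show "(\<sigma> ^^ ?m) a = a" by (rule funpow_dist1_prop[OF assms])
  show "inj_on (\<lambda>s. (\<sigma> ^^ s) a) {..<?m}" using inj_on_funpow_dist1[OF assms] by (simp add: lessThan_atLeast0)
  show "orbit \<sigma> a = (\<lambda>s. (\<sigma> ^^ s) a) ` {..<?m}" using orbit_conv_funpow_dist1[OF assms] by (simp add: lessThan_atLeast0)
qed

lemma orbit_image_bounded:
  assumes "(f ^^ n) x = x" "0 < n"
  shows "orbit f x = (\<lambda>s. (f ^^ s) x) ` {..<n}"
  unfolding orbit_altdef_bounded[OF assms] by auto

lemma orbit_transpose_split:
  assumes m: "(\<sigma> ^^ m) a = a" "inj_on (\<lambda>s. (\<sigma> ^^ s) a) {..<m}" and t: "0 < t" "t < m"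
    and b: "b = (\<sigma> ^^ t) a"
  shows "orbit (Transposition.transpose a b \<circ> \<sigma>) a = (\<lambda>s. (\<sigma> ^^ s) a) ` {..<t}"
    and "orbit (Transposition.transpose a b \<circ> \<sigma>) b = (\<lambda>s. (\<sigma> ^^ s) a) ` {t..<m}"
proof -
  let ?s = "Transposition.transpose a b \<circ> \<sigma>"
  have ne: "(\<sigma> ^^ s) a \<notin> {a, b}" if "0 < s" "s < m" "s \<noteq> t" for s
    using inj_onD[OF m(2), of s 0] inj_onD[OF m(2), of s t] that t b by auto
  have ne1: "(\<sigma> ^^ s) a \<notin> {a, b}" if "0 < s" "s < t" for s
    using ne that t by simp
  have per1: "(?s ^^ t) a = a"
    using transpose_iterate(2)[OF ne1 t(1)] b by simp
  show "orbit ?s a = (\<lambda>s. (\<sigma> ^^ s) a) ` {..<t}"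
    unfolding orbit_image_bounded[OF per1 t(1)]
    by (intro image_cong refl transpose_iterate(1)[OF ne1]) auto
  have sb: "(\<sigma> ^^ s) b = (\<sigma> ^^ (t + s)) a" for s
    unfolding b by (simp add: add.commute funpow_add)
  have ne2: "(\<sigma> ^^ s) b \<notin> {a, b}" if "0 < s" "s < m - t" for s
    unfolding sb using ne[of "t + s"] that by simp
  have mt: "0 < m - t" using t by simp
  have "(\<sigma> ^^ (m - t)) b = a" unfolding sb using m(1) t by simp
  then have per2: "(?s ^^ (m - t)) b = b"
    using transpose_iterate(2)[OF ne2 mt] by simp
  have "orbit ?s b = (\<lambda>s. (\<sigma> ^^ (t + s)) a) ` {..<m - t}"
    unfolding orbit_image_bounded[OF per2 mt] sb[symmetric]
    by (intro image_cong refl transpose_iterate(1)[OF ne2]) auto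
  also have "\<dots> = (\<lambda>s. (\<sigma> ^^ s) a) ` ((+) t ` {..<m - t})" by (simp add: image_image)
  also have "(+) t ` {..<m - t} = {t..<m}"
    using t by (simp add: lessThan_atLeast0)
  finally show "orbit ?s b = (\<lambda>s. (\<sigma> ^^ s) a) ` {t..<m}" .
qed

lemma orbit_transpose_merge:
  assumes a: "a \<in> orbit \<sigma> a" and b: "b \<in> orbit \<sigma> b" and ab: "b \<notin> orbit \<sigma> a"
  shows "orbit (Transposition.transpose a b \<circ> \<sigma>) a = orbit \<sigma> a \<union> orbit \<sigma> b"
proof -
  let ?s = "Transposition.transpose a b \<circ> \<sigma>"
  have ba: "a \<notin> orbit \<sigma> b" using a b ab by (metis orbit_swap)
  have half: "\<exists>m>0. (\<forall>s<m. ((Transposition.transpose c d \<circ> \<sigma>) ^^ s) c = (\<sigma> ^^ s) c) \<and>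
      ((Transposition.transpose c d \<circ> \<sigma>) ^^ m) c = d \<and> orbit \<sigma> c = (\<lambda>s. (\<sigma> ^^ s) c) ` {..<m}"
    if c: "c \<in> orbit \<sigma> c" and d: "d \<notin> orbit \<sigma> c" for c d
  proof -
    obtain m where m: "0 < m" "(\<sigma> ^^ m) c = c" "inj_on (\<lambda>s. (\<sigma> ^^ s) c) {..<m}"
      "orbit \<sigma> c = (\<lambda>s. (\<sigma> ^^ s) c) ` {..<m}"
      using self_orbit_period[OF c] by blast
    have ne: "(\<sigma> ^^ s) c \<notin> {c, d}" if "0 < s" "s < m" for s
      using inj_onD[OF m(3), of s 0] that d m(4) by auto
    show ?thesis
      using transpose_iterate[OF ne] m(1,2,4) by (intro exI[of _ m]) simp
  qed
  obtain m where m: "0 < m" "\<And>s. s < m \<Longrightarrow> (?s ^^ s) a = (\<sigma> ^^ s) a" "(?s ^^ m) a = b"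
    "orbit \<sigma> a = (\<lambda>s. (\<sigma> ^^ s) a) ` {..<m}"
    using half[OF a ab] by blast
  obtain l where l: "0 < l" "\<And>s. s < l \<Longrightarrow> (?s ^^ s) b = (\<sigma> ^^ s) b" "(?s ^^ l) b = a"
    "orbit \<sigma> b = (\<lambda>s. (\<sigma> ^^ s) b) ` {..<l}"
    using half[OF b ba] unfolding transpose_commute[of b a] by blast
  have per: "(?s ^^ (l + m)) a = a" "0 < l + m" using m(1,3) l(3) by (simp_all add: funpow_add)
  have sm: "(?s ^^ (m + s)) a = (?s ^^ s) b" for s
    using m(3) by (simp add: add.commute[of m] funpow_add)
  have "orbit ?s a = (\<lambda>s. (?s ^^ s) a) ` {..<m + l}"
    unfolding orbit_image_bounded[OF per] by (simp only: add.commute)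
  also have "{..<m + l} = {..<m} \<union> (+) m ` {..<l}"
    by (auto simp: image_iff lessThan_atLeast0)
  also have "(\<lambda>s. (?s ^^ s) a) ` \<dots> = (\<lambda>s. (?s ^^ s) a) ` {..<m} \<union> (\<lambda>s. (?s ^^ s) b) ` {..<l}"
    unfolding image_Un image_image sm ..
  also have "\<dots> = orbit \<sigma> a \<union> orbit \<sigma> b"
    unfolding m(4) l(4) using m(2) l(2) by (intro arg_cong2[where f="(\<union>)"] image_cong refl) auto
  finally show ?thesis .
qed

lemma orbit_transpose_other:
  assumes "x \<in> orbit \<sigma> x" "a \<notin> orbit \<sigma> x" "b \<notin> orbit \<sigma> x"
  shows "orbit (Transposition.transpose a b \<circ> \<sigma>) x = orbit \<sigma> x"
proof (rule orbit_cong[OF assms(1)])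
  fix s assume "s \<in> orbit \<sigma> x"
  then have "\<sigma> s \<in> orbit \<sigma> x" by (rule orbit.step)
  then show "(Transposition.transpose a b \<circ> \<sigma>) s = \<sigma> s" using assms by (simp add: Transposition.transpose_def) metis
qed

section \<open>Power sum products with gaps\<close>

text \<open>
  The trace monomial \<open>\<Prod>\<^sub>c Tr (\<Prod>\<^sub>k\<^sub>\<in>\<^sub>c M\<^sub>k)\<close> over the cycles \<open>c\<close> of \<open>\<sigma>\<close>, where \<open>M\<^sub>k\<close> is the identity
  matrix for \<open>k \<in> S\<close> and the matrix with eigenvalues \<open>x\<close> otherwise.
\<close>

definition gap_psum :: "nat \<Rightarrow> nat set \<Rightarrow> nat set \<Rightarrow> (nat \<Rightarrow> nat) \<Rightarrow> (nat \<Rightarrow> complex) \<Rightarrow> complex" where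
  "gap_psum N A S \<sigma> x = (\<Prod>c\<in>cycles_on A \<sigma>. power_sum N (card (c - S)) x)"

context
  fixes A :: "nat set" and \<sigma> :: "nat \<Rightarrow> nat"
  assumes fin: "finite A" and perm: "\<sigma> permutes A"
begin

lemma self_in_orbit: "x \<in> orbit \<sigma> x"
  by (rule permutation_self_in_orbit) (use fin perm permutation_permutes in blast)

lemma orbit_eq: "y \<in> orbit \<sigma> x \<Longrightarrow> orbit \<sigma> y = orbit \<sigma> x"
  using orbit_cyclic_eq3 cyclic_on_orbit[OF perm fin] by metis

lemma cycles_on_memD:
  assumes "c \<in> cycles_on A \<sigma>" "x \<in> c"
  shows "c = orbit \<sigma> x" "x \<in> A"
proof -
  obtain z where z: "z \<in> A" "c = orbit \<sigma> z" using assms(1) unfolding cycles_on_def by (elim imageE)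
  show "c = orbit \<sigma> x" using orbit_eq[of x z] assms(2) z by simp
  show "x \<in> A" using permutes_orbit_subset[OF perm z(1)] z(2) assms(2) by blast
qed

lemma finite_cycles_on: "finite (cycles_on A \<sigma>)"
  unfolding cycles_on_def using fin by simp

lemma finite_cycle: "c \<in> cycles_on A \<sigma> \<Longrightarrow> finite c"
  using cycles_on_memD(2) fin by (meson finite_subset subsetI)

lemma sum_by_cycles:
  fixes f :: "nat \<Rightarrow> complex"
  shows "(\<Sum>a\<in>A - S. f a) = (\<Sum>c\<in>cycles_on A \<sigma>. \<Sum>a\<in>c - S. f a)"
proof -
  have "x \<in> (\<Union>c\<in>cycles_on A \<sigma>. c - S)" if "x \<in> A - S" for x
    using that self_in_orbit[of x] unfolding cycles_on_def by (intro UN_I[of "orbit \<sigma> x"]) simp_all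
  then have "A - S = (\<Union>c\<in>cycles_on A \<sigma>. c - S)"
    by (intro equalityI subsetI) (auto dest: cycles_on_memD(2))
  moreover have "(\<Sum>a\<in>(\<Union>c\<in>cycles_on A \<sigma>. c - S). f a) = (\<Sum>c\<in>cycles_on A \<sigma>. \<Sum>a\<in>c - S. f a)"
  proof (rule sum.UNION_disjoint[OF finite_cycles_on])
    show "\<forall>c\<in>cycles_on A \<sigma>. finite (c - S)" by (simp add: finite_cycle)
    show "\<forall>c\<in>cycles_on A \<sigma>. \<forall>d\<in>cycles_on A \<sigma>. c \<noteq> d \<longrightarrow> (c - S) \<inter> (d - S) = {}"
    proof (intro ballI impI equals0I)
      fix c d z assume *: "c \<in> cycles_on A \<sigma>" "d \<in> cycles_on A \<sigma>" "c \<noteq> d" "z \<in> (c - S) \<inter> (d - S)"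
      then show False using cycles_on_memD(1)[OF *(1), of z] cycles_on_memD(1)[OF *(2), of z] by simp
    qed
  qed
  ultimately show ?thesis by simp
qed

lemma sum_card_cycles: "(\<Sum>c\<in>cycles_on A \<sigma>. card (c - S)) = card (A - S)"
proof -
  have "of_nat (\<Sum>c\<in>cycles_on A \<sigma>. card (c - S)) = (of_nat (card (A - S)) :: complex)"
    using sum_by_cycles[of "\<lambda>_. 1" S] by simp
  then show ?thesis unfolding of_nat_eq_iff .
qed

lemma cycles_on_transpose:
  assumes "a \<in> A" "b \<in> A"
  shows "cycles_on A (Transposition.transpose a b \<circ> \<sigma>)
    = (cycles_on A \<sigma> - {orbit \<sigma> a, orbit \<sigma> b})
      \<union> orbit (Transposition.transpose a b \<circ> \<sigma>) ` (orbit \<sigma> a \<union> orbit \<sigma> b)"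
proof -
  let ?s = "Transposition.transpose a b \<circ> \<sigma>" and ?U = "orbit \<sigma> a \<union> orbit \<sigma> b"
  have other: "orbit ?s x = orbit \<sigma> x" if "x \<notin> ?U" for x
    using orbit_transpose_other[OF self_in_orbit] that orbit_eq self_in_orbit by blast
  have "?U \<subseteq> A" using assms permutes_orbit_subset[OF perm] by blast
  then have "cycles_on A ?s = orbit ?s ` (A - ?U) \<union> orbit ?s ` ?U"
    unfolding cycles_on_def by blast
  also have "orbit ?s ` (A - ?U) = orbit \<sigma> ` (A - ?U)"
    using other by (intro image_cong) auto
  also have "\<dots> = cycles_on A \<sigma> - {orbit \<sigma> a, orbit \<sigma> b}"
    unfolding cycles_on_def using orbit_eq self_in_orbit by auto
  finally show ?thesis .
qed

lemma gap_psum_merge: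
  assumes a: "a \<in> A - S" and b: "b \<in> A - S" and ab: "b \<notin> orbit \<sigma> a"
  shows "gap_psum N A (S \<union> {a, b}) (Transposition.transpose a b \<circ> \<sigma>) x
    = power_sum N (card (orbit \<sigma> a - S) + card (orbit \<sigma> b - S) - 2) x
      * (\<Prod>e\<in>cycles_on A \<sigma> - {orbit \<sigma> a} - {orbit \<sigma> b}. power_sum N (card (e - S)) x)"
proof -
  let ?s = "Transposition.transpose a b \<circ> \<sigma>" and ?U = "orbit \<sigma> a \<union> orbit \<sigma> b"
  let ?R = "cycles_on A \<sigma> - {orbit \<sigma> a, orbit \<sigma> b}"
  have U: "orbit ?s a = ?U"
    by (rule orbit_transpose_merge[OF self_in_orbit self_in_orbit ab])
  have "?s permutes A" using perm a b by (auto intro: permutes_compose permutes_swap_id)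
  then have "cyclic_on ?s ?U" using cyclic_on_orbit[OF _ fin] U by metis
  then have "orbit ?s ` ?U = (\<lambda>_. ?U) ` ?U"
    by (intro image_cong refl orbit_cyclic_eq3)
  then have "orbit ?s ` ?U = {?U}" using self_in_orbit[of a] by auto
  then have cyc: "cycles_on A ?s = insert ?U ?R"
    using cycles_on_transpose a b by simp
  have disj: "orbit \<sigma> a \<inter> orbit \<sigma> b = {}" using ab orbit_eq self_in_orbit by blast
  have "?U \<notin> ?R"
    using cycles_on_memD(1)[of ?U a] self_in_orbit by blast
  then have "gap_psum N A (S \<union> {a, b}) ?s x
      = power_sum N (card (?U - (S \<union> {a, b}))) x * (\<Prod>e\<in>?R. power_sum N (card (e - (S \<union> {a, b}))) x)"
    unfolding gap_psum_def cyc using finite_cycles_on by simp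
  also have "(\<Prod>e\<in>?R. power_sum N (card (e - (S \<union> {a, b}))) x) = (\<Prod>e\<in>?R. power_sum N (card (e - S)) x)"
  proof (intro prod.cong refl)
    fix e assume "e \<in> ?R"
    then have "a \<notin> e" "b \<notin> e" using cycles_on_memD(1) by blast+
    then have "e - (S \<union> {a, b}) = e - S" by blast
    then show "power_sum N (card (e - (S \<union> {a, b}))) x = power_sum N (card (e - S)) x" by simp
  qed
  also have "card (?U - (S \<union> {a, b})) = card (orbit \<sigma> a - S) + card (orbit \<sigma> b - S) - 2"
  proof -
    have f: "finite (orbit \<sigma> a)" "finite (orbit \<sigma> b)" by (rule finite_orbit[OF self_in_orbit])+
    have "?U - (S \<union> {a, b}) = ((orbit \<sigma> a - S) \<union> (orbit \<sigma> b - S)) - {a, b}" by blast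
    moreover have "{a, b} \<subseteq> (orbit \<sigma> a - S) \<union> (orbit \<sigma> b - S)" using a b self_in_orbit by auto
    moreover have "card ((orbit \<sigma> a - S) \<union> (orbit \<sigma> b - S)) = card (orbit \<sigma> a - S) + card (orbit \<sigma> b - S)"
      using f disj by (intro card_Un_disjoint) auto
    moreover have "a \<noteq> b" using ab self_in_orbit by blast
    ultimately show ?thesis using f by (simp add: card_Diff_subset)
  qed
  also have "?R = cycles_on A \<sigma> - {orbit \<sigma> a} - {orbit \<sigma> b}" by blast
  finally show ?thesis .
qed

text \<open>
  Number the cycle as \<open>\<sigma>\<^sup>s a\<close> with \<open>0 \<le> s < m\<close>. For \<open>b = \<sigma>\<^sup>t a\<close> it splits into \<open>s < t\<close> and
  \<open>s \<ge> t\<close>, and \<open>a\<close> and \<open>b\<close> themselves become gaps, so the piece of \<open>a\<close> retains as many elements as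
  there are non-gaps strictly between \<open>a\<close> and \<open>b\<close>.
\<close>

lemma sum_gap_psum_split:
  assumes a: "a \<in> A - S"
  shows "(\<Sum>b\<in>orbit \<sigma> a - S - {a}. gap_psum N A (S \<union> {a, b}) (Transposition.transpose a b \<circ> \<sigma>) x)
    = (\<Sum>u<card (orbit \<sigma> a - S) - 1. power_sum N u x * power_sum N (card (orbit \<sigma> a - S) - 2 - u) x)
      * (\<Prod>e\<in>cycles_on A \<sigma> - {orbit \<sigma> a}. power_sum N (card (e - S)) x)"
proof -
  let ?o = "orbit \<sigma> a" and ?p = "\<lambda>s. (\<sigma> ^^ s) a"
  let ?R = "cycles_on A \<sigma> - {?o}"
  let ?P = "\<Prod>e\<in>?R. power_sum N (card (e - S)) x"
  obtain m where m: "0 < m" "?p m = a" "inj_on ?p {..<m}" "?o = ?p ` {..<m}"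
    using self_orbit_period[OF self_in_orbit] by blast
  \<comment> \<open>positions on the cycle, counted from \<open>a\<close>, of the admissible \<open>b\<close>\<close>
  define I where "I = {s \<in> {..<m}. 0 < s \<and> ?p s \<notin> S}"
  have finI: "finite I" unfolding I_def by simp
  have inj: "inj_on ?p J" if "J \<subseteq> {..<m}" for J using m(3) that by (rule inj_on_subset)
  have injI: "inj_on ?p I" by (rule inj) (auto simp: I_def)
  have pI: "?p ` J - {a} = ?p ` (J - {0})" if "J \<subseteq> {..<m}" for J
    using inj_onD[OF m(3), of _ 0] that m(1) by auto
  have oI: "?o - S - {a} = ?p ` I"
  proof -
    have "?o - S - {a} = ?p ` ({..<m} - {0}) - S"
      using pI[OF order_refl] unfolding m(4) by blast
    also have "\<dots> = ?p ` I" unfolding I_def by (auto intro!: imageI)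
    finally show ?thesis .
  qed
  have cardI: "card I = card (?o - S) - 1"
  proof -
    have "card I = card (?o - S - {a})" unfolding oI by (rule card_image[OF injI, symmetric])
    then show ?thesis using a self_in_orbit by simp
  qed
  have summand: "gap_psum N A (S \<union> {a, ?p t}) (Transposition.transpose a (?p t) \<circ> \<sigma>) x
      = power_sum N (card {s\<in>I. s < t}) x * power_sum N (card I - 1 - card {s\<in>I. s < t}) x * ?P"
    if "t \<in> I" for t
  proof -
    let ?b = "?p t"
    let ?s = "Transposition.transpose a ?b \<circ> \<sigma>" and ?S = "S \<union> {a, ?b}"
    have t: "0 < t" "t < m" "?b \<notin> S" using that by (auto simp: I_def)
    have b: "?b \<in> ?o" using m(4) t by auto
    then have bA: "?b \<in> A" using a permutes_orbit_subset[OF perm] by blast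
    have ob: "orbit \<sigma> ?b = ?o" by (rule orbit_eq[OF b])
    note split = orbit_transpose_split[OF m(2,3) t(1,2) refl]
    let ?c1 = "?p ` {..<t}" and ?c2 = "?p ` {t..<m}"
    have s_perm: "?s permutes A" using perm a bA by (auto intro: permutes_compose permutes_swap_id)
    have cy: "cyclic_on ?s ?c1" "cyclic_on ?s ?c2"
      using cyclic_on_orbit[OF s_perm fin] split by metis+
    have o12: "?o = ?c1 \<union> ?c2" unfolding m(4) image_Un[symmetric]
      using t by (intro arg_cong[where f="image ?p"]) auto
    have ac: "a \<in> ?c1" "?b \<in> ?c2" using t by (auto intro: image_eqI[of _ _ 0])
    have "orbit ?s ` ?c1 = (\<lambda>_. ?c1) ` ?c1" "orbit ?s ` ?c2 = (\<lambda>_. ?c2) ` ?c2"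
      by (intro image_cong refl orbit_cyclic_eq3 cy; assumption)+
    then have "orbit ?s ` ?o = {?c1, ?c2}"
      unfolding o12 image_Un[of "orbit ?s"] using ac by (metis empty_iff image_constant_conv insert_is_Un)
    then have cyc: "cycles_on A ?s = insert ?c1 (insert ?c2 ?R)"
      using cycles_on_transpose[of a ?b] a bA ob by simp
    have "?c1 \<inter> ?c2 = ?p ` ({..<t} \<inter> {t..<m})"
      using t by (intro inj_on_image_Int[OF m(3), symmetric]) auto
    then have disj: "?c1 \<inter> ?c2 = {}" by auto
    have ne: "?c1 \<noteq> ?c2" using disj ac by blast
    have notR: "?c1 \<notin> ?R" "?c2 \<notin> ?R"
      using cycles_on_memD(1) ac ob by (metis DiffE insertI1)+
    have "gap_psum N A ?S ?s x = power_sum N (card (?c1 - ?S)) x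
        * (power_sum N (card (?c2 - ?S)) x * (\<Prod>e\<in>?R. power_sum N (card (e - ?S)) x))"
      unfolding gap_psum_def cyc using finite_cycles_on ne notR by simp
    moreover have "(\<Prod>e\<in>?R. power_sum N (card (e - ?S)) x) = ?P"
    proof (intro prod.cong refl)
      fix e assume e: "e \<in> ?R"
      have "a \<notin> e" "?b \<notin> e" using e cycles_on_memD(1)[of e] ob by blast+
      then have "e - ?S = e - S" by blast
      then show "power_sum N (card (e - ?S)) x = power_sum N (card (e - S)) x" by simp
    qed
    moreover have "card (?c1 - ?S) = card {s\<in>I. s < t}"
    proof -
      have "?c1 - ?S = (?p ` {..<t} - {a}) - S" using disj ac by blast
      also have "\<dots> = ?p ` ({..<t} - {0}) - S" using pI[of "{..<t}"] t by simp
      also have "\<dots> = ?p ` {s\<in>I. s < t}" using t by (auto simp: I_def)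
      finally show ?thesis using card_image[OF inj, of "{s\<in>I. s < t}"] by (auto simp: I_def)
    qed
    moreover have "card (?c2 - ?S) = card {s\<in>I. t < s}"
    proof -
      have "?p ` {t..<m} - {?b} = ?p ` ({t..<m} - {t})"
        using inj_onD[OF m(3), of _ t] t by auto
      then have "?c2 - ?S = ?p ` ({t..<m} - {t}) - S" using disj ac by blast
      also have "\<dots> = ?p ` {s\<in>I. t < s}" using t by (auto simp: I_def)
      finally show ?thesis using card_image[OF inj, of "{s\<in>I. t < s}"] by (auto simp: I_def)
    qed
    moreover have "card {s\<in>I. t < s} = card I - 1 - card {s\<in>I. s < t}"
    proof -
      have "I = insert t ({s\<in>I. s < t} \<union> {s\<in>I. t < s})" using that by auto
      then have "card I = card (insert t ({s\<in>I. s < t} \<union> {s\<in>I. t < s}))" by metis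
      also have "\<dots> = Suc (card {s\<in>I. s < t} + card {s\<in>I. t < s})"
        using finI by (simp add: card_Un_disjoint disjoint_iff)
      finally show ?thesis by simp
    qed
    ultimately show ?thesis by (simp add: mult.assoc)
  qed
  have "(\<Sum>b\<in>?o - S - {a}. gap_psum N A (S \<union> {a, b}) (Transposition.transpose a b \<circ> \<sigma>) x)
      = (\<Sum>t\<in>I. gap_psum N A (S \<union> {a, ?p t}) (Transposition.transpose a (?p t) \<circ> \<sigma>) x)"
    unfolding oI by (rule sum.reindex_cong[OF injI refl refl])
  also have "\<dots> = (\<Sum>t\<in>I. power_sum N (card {s\<in>I. s < t}) x * power_sum N (card I - 1 - card {s\<in>I. s < t}) x) * ?P"
    unfolding sum_distrib_right by (intro sum.cong refl summand)
  also have "\<dots> = (\<Sum>u<card I. power_sum N u x * power_sum N (card I - 1 - u) x) * ?P"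
    by (subst sum_over_ranks[OF finI, where g="\<lambda>u. power_sum N u x * power_sum N (card I - 1 - u) x"]) (rule refl)
  finally show ?thesis unfolding cardI by (simp add: diff_diff_left numeral_2_eq_2)
qed

text \<open>
  For \<open>a\<close> in the cycle \<open>c\<close>, the \<open>b\<close> in \<open>c\<close> produce the sum for \<open>D\<^sup>* P\<^sub>k\<close> without its factor \<open>k\<close>,
  and each \<open>b\<close> in another cycle produces the cross term without its two factors. Counting the
  choices of \<open>a\<close> and \<open>b\<close> restores them.
\<close>

lemma D_star_gap_psum:
  assumes inj: "inj_on x {1..N}"
  shows "D_star N (gap_psum N A S \<sigma>) x
    = (\<Sum>a\<in>A - S. \<Sum>b\<in>A - S - {a}. gap_psum N A (S \<union> {a, b}) (Transposition.transpose a b \<circ> \<sigma>) x)"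
proof -
  let ?C = "cycles_on A \<sigma>" and ?k = "\<lambda>c. card (c - S)"
  let ?G = "\<lambda>a b. gap_psum N A (S \<union> {a, b}) (Transposition.transpose a b \<circ> \<sigma>) x"
  let ?L = "\<lambda>c. (\<Sum>u<?k c - 1. power_sum N u x * power_sum N (?k c - 2 - u) x) * (\<Prod>e\<in>?C - {c}. power_sum N (?k e) x)"
  let ?M = "\<lambda>c d. power_sum N (?k c + ?k d - 2) x * (\<Prod>e\<in>?C - {c} - {d}. power_sum N (?k e) x)"
  have inner: "(\<Sum>b\<in>A - S - {a}. ?G a b) = ?L c + (\<Sum>d\<in>?C - {c}. of_nat (?k d) * ?M c d)"
    if c: "c \<in> ?C" "a \<in> c - S" for c a
  proof -
    have Sa: "Z - S - {a} = Z - (S \<union> {a})" for Z by blast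
    have ac: "a \<in> c" "a \<notin> S" using c(2) by auto
    have ca: "c = orbit \<sigma> a" and aA: "a \<in> A - S"
      using cycles_on_memD[OF c(1) ac(1)] ac(2) by (simp_all only: DiffI not_False_eq_True)
    have "(\<Sum>b\<in>A - S - {a}. ?G a b) = (\<Sum>d\<in>?C. \<Sum>b\<in>d - (S \<union> {a}). ?G a b)"
      unfolding Sa by (rule sum_by_cycles)
    also have "\<dots> = (\<Sum>b\<in>c - (S \<union> {a}). ?G a b) + (\<Sum>d\<in>?C - {c}. \<Sum>b\<in>d - (S \<union> {a}). ?G a b)"
      by (rule sum.remove[OF finite_cycles_on c(1)])
    also have "(\<Sum>b\<in>c - (S \<union> {a}). ?G a b) = ?L c"
      unfolding Sa[symmetric] ca by (rule sum_gap_psum_split[OF aA])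
    also have "(\<Sum>d\<in>?C - {c}. \<Sum>b\<in>d - (S \<union> {a}). ?G a b) = (\<Sum>d\<in>?C - {c}. of_nat (?k d) * ?M c d)"
    proof (intro sum.cong refl)
      fix d assume d: "d \<in> ?C - {c}"
      then have "a \<notin> d" using cycles_on_memD(1)[of d a] ca by blast
      then have "d - (S \<union> {a}) = d - S" by blast
      moreover have "?G a b = ?M c d" if b: "b \<in> d - S" for b
      proof -
        have dC: "d \<in> ?C" "d \<noteq> c" and bd: "b \<in> d" "b \<notin> S" using d b by blast+
        have db: "d = orbit \<sigma> b" and bA: "b \<in> A - S"
          using cycles_on_memD[OF dC(1) bd(1)] bd(2) by (simp_all only: DiffI not_False_eq_True)
        have "b \<notin> orbit \<sigma> a" using dC(2) orbit_eq[of b a] unfolding ca db by metis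
        then show ?thesis unfolding ca db by (rule gap_psum_merge[OF aA bA])
      qed
      ultimately show "(\<Sum>b\<in>d - (S \<union> {a}). ?G a b) = of_nat (?k d) * ?M c d" by simp
    qed
    finally show ?thesis .
  qed
  have "(\<Sum>a\<in>A - S. \<Sum>b\<in>A - S - {a}. ?G a b) = (\<Sum>c\<in>?C. \<Sum>a\<in>c - S. \<Sum>b\<in>A - S - {a}. ?G a b)"
    by (rule sum_by_cycles)
  also have "\<dots> = (\<Sum>c\<in>?C. of_nat (?k c) * (?L c + (\<Sum>d\<in>?C - {c}. of_nat (?k d) * ?M c d)))"
    by (intro sum.cong refl) (simp only: inner sum_constant cong: sum.cong)
  also have "\<dots> = (\<Sum>c\<in>?C. of_nat (?k c) * ?L c) + (\<Sum>c\<in>?C. \<Sum>d\<in>?C - {c}. of_nat (?k c) * (of_nat (?k d) * ?M c d))"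
    by (simp only: distrib_left sum.distrib sum_distrib_left)
  also have "\<dots> = D_star N (\<lambda>x. \<Prod>c\<in>?C. power_sum N (?k c) x) x"
    unfolding D_star_prod_power_sum[OF inj] by (simp only: mult.assoc)
  finally show ?thesis unfolding gap_psum_def[abs_def] by (rule sym)
qed

lemma E_star_gap_psum: "E_star N (gap_psum N A S \<sigma>) x = of_nat (card (A - S)) * gap_psum N A S \<sigma> x"
  unfolding gap_psum_def[abs_def] E_star_prod_power_sum[OF finite_cycles_on] sum_card_cycles ..

lemma poly_below_gap_psum: "poly_below N (Suc (card (A - S))) (gap_psum N A S \<sigma>)"
  unfolding gap_psum_def[abs_def] sum_card_cycles[symmetric]
  by (intro poly_below_prod finite_cycles_on poly_below_power_sum)

end

lemma gap_psum_permute: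
  assumes "\<rho> permutes {1..N}"
  shows "gap_psum N A S \<sigma> (x \<circ> \<rho>) = gap_psum N A S \<sigma> x"
  unfolding gap_psum_def power_sum_permute[OF assms] ..

section \<open>Erasing and relabelling\<close>

lemma
  assumes x: "x \<notin> S" "x \<in> orbit \<sigma> x"
  shows erase_in_orbit: "erase S \<sigma> x \<in> orbit \<sigma> x" and erase_notin: "erase S \<sigma> x \<notin> S"
    and funpow_erase: "0 < j \<Longrightarrow> (\<sigma> ^^ j) x \<notin> S \<Longrightarrow> (\<sigma> ^^ j) x \<noteq> erase S \<sigma> x \<Longrightarrow>
      \<exists>i. 0 < i \<and> i < j \<and> (\<sigma> ^^ j) x = (\<sigma> ^^ i) (erase S \<sigma> x)"
proof -
  let ?P = "\<lambda>j. 0 < j \<and> (\<sigma> ^^ j) x \<notin> S"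
  have e: "erase S \<sigma> x = (\<sigma> ^^ (LEAST j. ?P j)) x"
    using x(1) by (simp add: erase_def)
  obtain j0 where "0 < j0" "x = (\<sigma> ^^ j0) x" using x(2) unfolding orbit_altdef mem_Collect_eq by blast
  then have "?P j0" using x(1) by metis
  then have P: "?P (LEAST j. ?P j)" by (rule LeastI)
  show "erase S \<sigma> x \<in> orbit \<sigma> x" "erase S \<sigma> x \<notin> S"
    unfolding e using P by (auto simp: orbit_altdef)
  assume j: "0 < j" "(\<sigma> ^^ j) x \<notin> S" "(\<sigma> ^^ j) x \<noteq> erase S \<sigma> x"
  let ?l = "LEAST j. ?P j"
  have "?l \<le> j" using j by (intro Least_le) simp
  moreover have "?l \<noteq> j" using j(3) unfolding e by blast
  ultimately have "?l < j" by simp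
  then show "\<exists>i. 0 < i \<and> i < j \<and> (\<sigma> ^^ j) x = (\<sigma> ^^ i) (erase S \<sigma> x)"
  proof (intro exI[of _ "j - ?l"] conjI)
    assume l: "?l < j"
    then show "0 < j - ?l" "j - ?l < j" using P by simp_all
    have "(\<sigma> ^^ (j - ?l + ?l)) x = (\<sigma> ^^ (j - ?l)) (erase S \<sigma> x)"
      unfolding e funpow_add o_apply ..
    then show "(\<sigma> ^^ j) x = (\<sigma> ^^ (j - ?l)) (erase S \<sigma> x)" using l by simp
  qed
qed

lemma orbit_erase:
  assumes self: "\<And>y. y \<in> orbit \<sigma> y" and x: "x \<notin> S"
  shows "orbit (erase S \<sigma>) x = orbit \<sigma> x - S"
proof (intro equalityI subsetI)
  fix y assume "y \<in> orbit (erase S \<sigma>) x"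
  then show "y \<in> orbit \<sigma> x - S"
  proof induction
    case base
    then show ?case using erase_in_orbit[OF x self] erase_notin[OF x self] by blast
  next
    case (step y)
    then have "y \<notin> S" by blast
    then show ?case
      using erase_in_orbit[OF _ self] erase_notin[OF _ self] orbit_trans step.IH by (metis DiffD1 DiffI)
  qed
next
  have *: "(\<sigma> ^^ j) y \<in> orbit (erase S \<sigma>) y" if "0 < j" "y \<notin> S" "(\<sigma> ^^ j) y \<notin> S" for j y
    using that
  proof (induction j arbitrary: y rule: less_induct)
    case (less j)
    show ?case
    proof (cases "(\<sigma> ^^ j) y = erase S \<sigma> y")
      case True
      then show ?thesis by (metis orbit.base)
    next
      case False
      then obtain i where i: "0 < i" "i < j" "(\<sigma> ^^ j) y = (\<sigma> ^^ i) (erase S \<sigma> y)"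
        using funpow_erase[OF less.prems(2) self less.prems(1,3)] by blast
      then have "(\<sigma> ^^ i) (erase S \<sigma> y) \<in> orbit (erase S \<sigma>) (erase S \<sigma> y)"
        using less.IH[OF i(2,1) erase_notin[OF less.prems(2) self]] less.prems(3) by simp
      then show ?thesis unfolding i(3) by (rule orbit_subset)
    qed
  qed
  fix y assume y: "y \<in> orbit \<sigma> x - S"
  then obtain j where "0 < j" "y = (\<sigma> ^^ j) x" unfolding orbit_altdef by blast
  then show "y \<in> orbit (erase S \<sigma>) x" using *[of j x] x y by blast
qed

text \<open>
  Every point is on its own orbit under the first-return map, so this map is surjective, and hence
  bijective on a finite set.
\<close>

lemma bij_betw_erase:
  assumes fin: "finite A" and perm: "\<sigma> permutes A"
  shows "bij_betw (erase S \<sigma>) (A - S) (A - S)"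
proof -
  let ?e = "erase S \<sigma>"
  have self: "y \<in> orbit \<sigma> y" for y
    by (rule permutation_self_in_orbit) (use fin perm permutation_permutes in blast)
  have orb: "orbit ?e x \<subseteq> A - S" "x \<in> orbit ?e x" if x: "x \<in> A - S" for x
  proof -
    have "orbit ?e x = orbit \<sigma> x - S" using x by (intro orbit_erase self) simp
    then show "orbit ?e x \<subseteq> A - S" "x \<in> orbit ?e x"
      using permutes_orbit_subset[OF perm, of x] self[of x] x by blast+
  qed
  have "?e ` (A - S) = A - S"
  proof (intro equalityI subsetI)
    fix y assume "y \<in> ?e ` (A - S)"
    then show "y \<in> A - S" using orb(1) orbit.base[of ?e] by blast
  next
    fix y assume y: "y \<in> A - S"
    from orb(2)[OF y] show "y \<in> ?e ` (A - S)"
    proof cases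
      case base
      then show ?thesis using y by (metis image_eqI)
    next
      case (step z)
      then show ?thesis using orb(1)[OF y] by blast
    qed
  qed
  then show ?thesis using fin by (simp add: bij_betw_def eq_card_imp_inj_on)
qed

lemma bij_betw_rank_in:
  assumes "finite B"
  shows "bij_betw (rank_in B) B {1..card B}"
proof -
  have less: "rank_in B x < rank_in B y" if "x \<in> B" "y \<in> B" "x < y" for x y
  proof -
    have "y \<in> {z\<in>B. z \<le> y}" "y \<notin> {z\<in>B. z \<le> x}" "{z\<in>B. z \<le> x} \<subseteq> {z\<in>B. z \<le> y}"
      using that by auto
    then have "{z\<in>B. z \<le> x} \<subset> {z\<in>B. z \<le> y}" by blast
    then show ?thesis unfolding rank_in_def using assms by (intro psubset_card_mono) auto
  qed
  have inj: "inj_on (rank_in B) B"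
    by (rule linorder_inj_onI') (use less in force)
  have "rank_in B x \<in> {1..card B}" if "x \<in> B" for x
  proof -
    have "{x} \<subseteq> {y\<in>B. y \<le> x}" "{y\<in>B. y \<le> x} \<subseteq> B" using that by auto
    then have "card {x} \<le> rank_in B x" "rank_in B x \<le> card B"
      unfolding rank_in_def using assms by (intro card_mono finite_subset[of "{y\<in>B. y \<le> x}" B]; simp)+
    then show ?thesis by simp
  qed
  then have "rank_in B ` B = {1..card B}"
    using card_image[OF inj] by (intro card_subset_eq) auto
  with inj show ?thesis by (simp add: bij_betw_def)
qed

lemma relabel_rank_in:
  assumes "finite B" "x \<in> B"
  shows "relabel B \<rho> (rank_in B x) = rank_in B (\<rho> x)"
  using bij_betw_rank_in[OF assms(1)] assms(2)
  by (auto simp: relabel_def bij_betw_def inv_into_f_f)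

lemma relabel_permutes:
  assumes fin: "finite B" and bij: "bij_betw \<rho> B B"
  shows "relabel B \<rho> permutes {1..card B}"
proof (rule bij_imp_permutes)
  let ?r = "rank_in B"
  note r = bij_betw_rank_in[OF fin]
  have "bij_betw (?r \<circ> (\<rho> \<circ> inv_into B ?r)) {1..card B} {1..card B}"
    by (intro bij_betw_trans[OF _ r] bij_betw_trans[OF bij_betw_inv_into[OF r] bij])
  then show "bij_betw (relabel B \<rho>) {1..card B} {1..card B}"
    by (rule iffD1[OF bij_betw_cong, rotated]) (simp add: relabel_def)
qed (auto simp: relabel_def)

lemma psum_perm_relabel:
  assumes fin: "finite B" and bij: "bij_betw \<rho> B B" and self: "\<And>x. x \<in> B \<Longrightarrow> x \<in> orbit \<rho> x"
  shows "psum_perm N (card B) (relabel B \<rho>) x = (\<Prod>c\<in>cycles_on B \<rho>. power_sum N (card c) x)"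
proof -
  let ?r = "rank_in B"
  note r = bij_betw_rank_in[OF fin]
  have orb: "orbit \<rho> y \<subseteq> B" if "y \<in> B" for y
  proof
    fix z assume "z \<in> orbit \<rho> y"
    then show "z \<in> B" using bij that by induction (auto simp: bij_betw_def)
  qed
  have "orbit (relabel B \<rho>) (?r y) = ?r ` orbit \<rho> y" if "y \<in> B" for y
    using orbit_inverse[OF self[OF that], of "relabel B \<rho>" ?r] relabel_rank_in[OF fin] orb[OF that] by blast
  then have "orbit (relabel B \<rho>) ` (?r ` B) = image ?r ` orbit \<rho> ` B"
    unfolding image_image by (intro image_cong refl)
  then have "cycles_on {1..card B} (relabel B \<rho>) = image ?r ` cycles_on B \<rho>"
    unfolding cycles_on_def using r by (simp add: bij_betw_def)
  moreover have sub: "c \<subseteq> B" if "c \<in> cycles_on B \<rho>" for c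
    using that orb unfolding cycles_on_def by blast
  moreover have "inj_on (image ?r) (cycles_on B \<rho>)"
    using r sub inj_on_image_eq_iff[of ?r B] by (intro inj_onI) (auto simp: bij_betw_def)
  moreover have "card (?r ` c) = card c" if "c \<in> cycles_on B \<rho>" for c
    using r sub[OF that] by (intro card_image) (auto simp: bij_betw_def intro: inj_on_subset)
  ultimately show ?thesis
    unfolding psum_perm_def power_sum_def by (simp add: prod.reindex)
qed

section \<open>Pairings as involutions\<close>

text \<open>
  Involutions are easier to modify than partitions: a pair is added or removed by composition with a
  transposition.
\<close>

definition invols :: "nat \<Rightarrow> (nat \<Rightarrow> nat) set" where
  "invols n = {p. p permutes {1..n} \<and> (\<forall>x. p (p x) = x)}"

definition msupp :: "(nat \<Rightarrow> nat) \<Rightarrow> nat set" where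
  "msupp p = {x. p x \<noteq> x}"

lemma finite_invols: "finite (invols n)"
  by (rule finite_subset[of _ "{p. p permutes {1..n}}"]) (auto simp: invols_def finite_permutations)

lemma msupp_subset: "p \<in> invols n \<Longrightarrow> msupp p \<subseteq> {1..n}"
  unfolding invols_def msupp_def by (auto dest: permutes_not_in)

lemma invols_iff: "p \<in> invols n \<longleftrightarrow> (\<forall>x. p (p x) = x) \<and> msupp p \<subseteq> {1..n}"
proof
  assume "p \<in> invols n"
  then show "(\<forall>x. p (p x) = x) \<and> msupp p \<subseteq> {1..n}"
    using msupp_subset by (auto simp: invols_def)
next
  assume *: "(\<forall>x. p (p x) = x) \<and> msupp p \<subseteq> {1..n}"
  then have pp: "p (p x) = x" for x by blast
  have "p x = x" if "x \<notin> {1..n}" for x using * that unfolding msupp_def by blast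
  moreover have "\<exists>!x. p x = y" for y by (rule ex1I[of _ "p y"]) (use pp in metis)+
  ultimately have "p permutes {1..n}" unfolding permutes_def by blast
  then show "p \<in> invols n" using * by (simp add: invols_def)
qed

lemma
  assumes p: "p \<in> invols n" and ab: "a \<in> {1..n}" "b \<in> {1..n}" "a \<noteq> b" "p a = a" "p b = b"
  shows msupp_transpose: "msupp (Transposition.transpose a b \<circ> p) = msupp p \<union> {a, b}"
    and invols_transpose: "Transposition.transpose a b \<circ> p \<in> invols n"
proof -
  let ?p = "Transposition.transpose a b \<circ> p"
  have pp: "p (p x) = x" for x using p by (simp add: invols_def)
  have ne: "p x \<noteq> a" "p x \<noteq> b" if "x \<noteq> a" "x \<noteq> b" for x using pp that ab(4,5) by metis+
  have val: "?p x = (if x = a then b else if x = b then a else p x)" for x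
    using ne ab by simp
  show m: "msupp ?p = msupp p \<union> {a, b}"
    unfolding msupp_def val using ab by auto
  have "?p (?p x) = x" for x
    unfolding val using ne pp ab by auto
  then show "?p \<in> invols n"
    unfolding invols_iff m using msupp_subset[OF p] ab by simp
qed

lemma
  assumes p: "p \<in> invols n" and a: "p a \<noteq> a"
  shows invols_remove: "Transposition.transpose a (p a) \<circ> p \<in> invols n"
    and invols_remove_fix: "(Transposition.transpose a (p a) \<circ> p) a = a"
      "(Transposition.transpose a (p a) \<circ> p) (p a) = p a"
proof -
  let ?p = "Transposition.transpose a (p a) \<circ> p"
  have pp: "p (p x) = x" for x using p by (simp add: invols_def)
  have ne: "p x \<noteq> a" "p x \<noteq> p a" if "x \<noteq> a" "x \<noteq> p a" for x using pp that by metis+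
  have val: "?p x = (if x = a \<or> x = p a then x else p x)" for x
    using ne pp by auto
  have "?p (?p x) = x" for x
    unfolding val using ne pp by auto
  moreover have "msupp ?p \<subseteq> msupp p" unfolding msupp_def val by auto
  ultimately show "?p \<in> invols n"
    unfolding invols_iff using msupp_subset[OF p] by blast
  show "?p a = a" "?p (p a) = p a" unfolding val by simp_all
qed

lemma card_msupp_transpose:
  assumes p: "p \<in> invols n" and ab: "a \<in> {1..n}" "b \<in> {1..n}" "a \<noteq> b" "p a = a" "p b = b"
  shows "card (msupp (Transposition.transpose a b \<circ> p)) = card (msupp p) + 2"
proof -
  have "finite (msupp p)" using msupp_subset[OF p] by (rule finite_subset) simp
  then show ?thesis unfolding msupp_transpose[OF assms] using ab by (simp add: msupp_def)
qed

text \<open>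
  A triple \<open>(p, a, b)\<close> is recovered from \<open>p' = (a b) \<circ> p\<close> and \<open>a\<close>: then \<open>b = p' a\<close>, and \<open>a\<close> may be
  any element of the support of \<open>p'\<close>.
\<close>

lemma sum_invols_insert:
  fixes F :: "(nat \<Rightarrow> nat) \<Rightarrow> complex"
  shows "(\<Sum>p\<in>invols n. \<Sum>a\<in>{1..n} - msupp p. \<Sum>b\<in>{1..n} - msupp p - {a}. F (Transposition.transpose a b \<circ> p))
    = (\<Sum>p\<in>invols n. of_nat (card (msupp p)) * F p)"
proof -
  let ?X = "SIGMA p:invols n. SIGMA a:{1..n} - msupp p. {1..n} - msupp p - {a}"
  let ?Y = "SIGMA p:invols n. msupp p"
  have fin: "finite (msupp p)" if "p \<in> invols n" for p
    using msupp_subset[OF that] by (rule finite_subset) simp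
  have X: "p \<in> invols n \<and> a \<in> {1..n} \<and> b \<in> {1..n} \<and> a \<noteq> b \<and> p a = a \<and> p b = b"
    if "(p, a, b) \<in> ?X" for p a b using that by (auto simp: msupp_def)
  have "(\<Sum>p\<in>invols n. \<Sum>a\<in>{1..n} - msupp p. \<Sum>b\<in>{1..n} - msupp p - {a}. F (Transposition.transpose a b \<circ> p))
      = (\<Sum>(p, a, b)\<in>?X. F (Transposition.transpose a b \<circ> p))"
    by (simp add: sum.Sigma finite_invols case_prod_beta)
  also have "\<dots> = (\<Sum>(p, a)\<in>?Y. F p)"
  proof (rule sum.reindex_bij_witness[where
        i = "\<lambda>(p, a). (Transposition.transpose a (p a) \<circ> p, a, p a)"
        and j = "\<lambda>(p, a, b). (Transposition.transpose a b \<circ> p, a)"])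
    fix z assume "z \<in> ?X"
    moreover obtain p a b where z: "z = (p, a, b)" by (cases z) auto
    ultimately have "(p, a, b) \<in> ?X" by (simp only:)
    from X[OF this] have *: "p \<in> invols n" "a \<in> {1..n}" "b \<in> {1..n}" "a \<noteq> b" "p a = a" "p b = b"
      by blast+
    show "(case case z of (p, a, b) \<Rightarrow> (Transposition.transpose a b \<circ> p, a) of
        (p, a) \<Rightarrow> (Transposition.transpose a (p a) \<circ> p, a, p a)) = z"
      unfolding z using *(5) by (simp add: fun_eq_iff)
    show "(case z of (p, a, b) \<Rightarrow> (Transposition.transpose a b \<circ> p, a)) \<in> ?Y"
      unfolding z using invols_transpose[OF *] msupp_transpose[OF *] by simp
    show "(case case z of (p, a, b) \<Rightarrow> (Transposition.transpose a b \<circ> p, a) of (p, a) \<Rightarrow> F p)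
        = (case z of (p, a, b) \<Rightarrow> F (Transposition.transpose a b \<circ> p))"
      unfolding z by simp
  next
    fix z assume "z \<in> ?Y"
    moreover obtain p a where z: "z = (p, a)" by (cases z) auto
    ultimately have "(p, a) \<in> ?Y" by (simp only:)
    then have p: "p \<in> invols n" and a: "p a \<noteq> a" unfolding msupp_def by blast+
    have "p (p a) = a" using p by (simp add: invols_def)
    then have "a \<in> msupp p" "p a \<in> msupp p" using a unfolding msupp_def mem_Collect_eq by metis+
    then have "a \<in> {1..n}" "p a \<in> {1..n}" using msupp_subset[OF p] by blast+
    then show "(case z of (p, a) \<Rightarrow> (Transposition.transpose a (p a) \<circ> p, a, p a)) \<in> ?X"
      unfolding z using invols_remove[OF p a] invols_remove_fix[OF p a] a by (simp add: msupp_def)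
    show "(case case z of (p, a) \<Rightarrow> (Transposition.transpose a (p a) \<circ> p, a, p a) of
        (p, a, b) \<Rightarrow> (Transposition.transpose a b \<circ> p, a)) = z"
      unfolding z by (simp add: fun_eq_iff)
  qed
  also have "\<dots> = (\<Sum>p\<in>invols n. \<Sum>a\<in>msupp p. F p)"
    by (rule sum.Sigma[symmetric]) (use finite_invols fin in auto)
  finally show ?thesis by simp
qed

lemma P12_block_unique:
  assumes "\<pi> \<in> P12 n" "B \<in> \<pi>" "B' \<in> \<pi>" "x \<in> B" "x \<in> B'"
  shows "B = B'"
  using assms unfolding P12_def partition_on_def disjoint_def by blast

lemma
  assumes \<pi>: "\<pi> \<in> P12 n"
  shows pair_invol_block: "x \<in> {1..n} \<Longrightarrow> {x, pair_invol \<pi> x} \<in> \<pi>"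
    and msupp_pair_invol: "msupp (pair_invol \<pi>) = pair_supp \<pi>"
    and pair_supp_subset: "pair_supp \<pi> \<subseteq> {1..n}"
proof -
  let ?p = "pair_invol \<pi>"
  have U: "\<Union>\<pi> = {1..n}" using \<pi> unfolding P12_def partition_on_def by blast
  show sub: "pair_supp \<pi> \<subseteq> {1..n}" unfolding pair_supp_def pairs_def U[symmetric] by blast
  have two: "?p x = y" "x \<in> pair_supp \<pi>" if "{x, y} \<in> \<pi>" "y \<noteq> x" for x y
  proof -
    have "card {x, y} = 2" using that(2) by simp
    then show s: "x \<in> pair_supp \<pi>" unfolding pair_supp_def pairs_def using that(1) by blast
    have "(THE z. z \<noteq> x \<and> {x, z} \<in> \<pi>) = y"
    proof (rule the_equality)
      fix z assume z: "z \<noteq> x \<and> {x, z} \<in> \<pi>"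
      have "{x, z} = {x, y}" by (rule P12_block_unique[OF \<pi>]) (use z that in auto)
      then show "z = y" using z by (metis insertE insertI1 insertI2 singletonD)
    qed (use that in simp)
    then show "?p x = y" using s by (simp add: pair_invol_def)
  qed
  have supp: "\<exists>y. {x, y} \<in> \<pi> \<and> y \<noteq> x" if x: "x \<in> pair_supp \<pi>" for x
  proof -
    obtain B where B: "B \<in> \<pi>" "card B = 2" "x \<in> B"
      using x unfolding pair_supp_def pairs_def by blast
    then obtain u v where "B = {u, v}" "u \<noteq> v" by (meson card_2_iff)
    then show ?thesis using B by (metis insert_commute insertE singletonD)
  qed
  have fixed: "?p x = x" if "x \<notin> pair_supp \<pi>" for x using that by (simp add: pair_invol_def)
  show "msupp ?p = pair_supp \<pi>"
  proof (intro equalityI subsetI)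
    fix x assume "x \<in> msupp ?p"
    then show "x \<in> pair_supp \<pi>" using fixed unfolding msupp_def by blast
  next
    fix x assume "x \<in> pair_supp \<pi>"
    then obtain y where "{x, y} \<in> \<pi>" "y \<noteq> x" using supp by blast
    then show "x \<in> msupp ?p" using two(1) unfolding msupp_def by simp
  qed
  assume x: "x \<in> {1..n}"
  show "{x, ?p x} \<in> \<pi>"
  proof (cases "x \<in> pair_supp \<pi>")
    case True
    then obtain y where "{x, y} \<in> \<pi>" "y \<noteq> x" using supp by blast
    then show ?thesis using two(1) by simp
  next
    case False
    obtain B where B: "B \<in> \<pi>" "x \<in> B" using x unfolding U[symmetric] by blast
    then have "B \<notin> pairs \<pi>" using False unfolding pair_supp_def by blast
    then have "card B = 1" using B \<pi> unfolding P12_def pairs_def by blast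
    then have "B = {x}" using B by (metis card_1_singletonE singletonD)
    then show ?thesis using B fixed[OF False] by simp
  qed
qed

lemma pair_invol_in_invols:
  assumes \<pi>: "\<pi> \<in> P12 n"
  shows "pair_invol \<pi> \<in> invols n"
proof -
  let ?p = "pair_invol \<pi>"
  have U: "\<Union>\<pi> = {1..n}" using \<pi> unfolding P12_def partition_on_def by blast
  have "?p (?p x) = x" for x
  proof (cases "x \<in> {1..n}")
    case True
    have b1: "{x, ?p x} \<in> \<pi>" by (rule pair_invol_block[OF \<pi> True])
    then have "?p x \<in> {1..n}" using U by blast
    then have b2: "{?p x, ?p (?p x)} \<in> \<pi>" by (rule pair_invol_block[OF \<pi>])
    have "{x, ?p x} = {?p x, ?p (?p x)}" by (rule P12_block_unique[OF \<pi> b1 b2, of "?p x"]) simp_all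
    then show ?thesis by (metis doubleton_eq_iff)
  next
    case False
    then have "?p x = x" using pair_supp_subset[OF \<pi>] by (auto simp: pair_invol_def)
    then show ?thesis by simp
  qed
  then show ?thesis
    unfolding invols_iff msupp_pair_invol[OF \<pi>] using pair_supp_subset[OF \<pi>] by blast
qed

lemma P12_eq_blocks:
  assumes \<pi>: "\<pi> \<in> P12 n"
  shows "\<pi> = (\<lambda>x. {x, pair_invol \<pi> x}) ` {1..n}"
proof (intro equalityI subsetI)
  fix B assume B: "B \<in> \<pi>"
  have U: "\<Union>\<pi> = {1..n}" and "B \<noteq> {}" using \<pi> B unfolding P12_def partition_on_def by blast+
  then obtain x where x: "x \<in> B" "x \<in> {1..n}" using B by blast
  have "B = {x, pair_invol \<pi> x}"
    by (rule P12_block_unique[OF \<pi> B pair_invol_block[OF \<pi> x(2)] x(1)]) simp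
  then show "B \<in> (\<lambda>x. {x, pair_invol \<pi> x}) ` {1..n}" using x(2) by blast
qed (use pair_invol_block[OF \<pi>] in blast)

lemma bij_betw_pair_invol: "bij_betw pair_invol (P12 n) (invols n)"
proof (rule bij_betw_imageI)
  show "inj_on pair_invol (P12 n)"
    by (rule inj_onI) (metis P12_eq_blocks)
  have "p \<in> pair_invol ` P12 n" if p: "p \<in> invols n" for p
  proof -
    let ?b = "\<lambda>x. {x, p x}"
    let ?\<pi> = "?b ` {1..n}"
    have pp: "p (p x) = x" for x using p by (simp add: invols_def)
    have same: "?b x = ?b y" if "z \<in> ?b x" "z \<in> ?b y" for x y z
      using that pp by (metis doubleton_eq_iff insertE singletonD)
    have in_n: "p x \<in> {1..n}" if "x \<in> {1..n}" for x
      using p that permutes_in_image[of p "{1..n}" x] by (simp add: invols_def)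
    have "partition_on {1..n} ?\<pi>"
      unfolding partition_on_def
    proof (intro conjI)
      show "\<Union>?\<pi> = {1..n}" using in_n by auto
      show "disjoint ?\<pi>" unfolding disjoint_def using same by blast
    qed auto
    moreover have "card B = 1 \<or> card B = 2" if "B \<in> ?\<pi>" for B
    proof -
      obtain x where "B = {x, p x}" using \<open>B \<in> ?\<pi>\<close> by blast
      then show ?thesis by (cases "p x = x") simp_all
    qed
    ultimately have \<pi>: "?\<pi> \<in> P12 n" unfolding P12_def by blast
    have "pair_invol ?\<pi> x = p x" for x
    proof (cases "x \<in> {1..n}")
      case True
      obtain z where "{x, pair_invol ?\<pi> x} = {z, p z}"
        using pair_invol_block[OF \<pi> True] by blast
      then have "x = z \<and> pair_invol ?\<pi> x = p z \<or> x = p z \<and> pair_invol ?\<pi> x = z"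
        unfolding doubleton_eq_iff .
      then show ?thesis using pp[of z] by (elim disjE conjE) (simp_all only:)
    next
      case False
      then have "pair_invol ?\<pi> x = x" "p x = x"
        using pair_supp_subset[OF \<pi>] msupp_subset[OF p] by (auto simp: pair_invol_def msupp_def)
      then show ?thesis by simp
    qed
    then have "pair_invol ?\<pi> = p" by (rule ext)
    then show ?thesis using imageI[OF \<pi>, of pair_invol] by (simp only:)
  qed
  then show "pair_invol ` P12 n = invols n"
    using pair_invol_in_invols by blast
qed

lemma card_pair_supp:
  assumes \<pi>: "\<pi> \<in> P12 n"
  shows "card (pair_supp \<pi>) = 2 * card (pairs \<pi>)"
proof -
  have "card (\<Union>(pairs \<pi>)) = sum card (pairs \<pi>)"
  proof (rule card_Union_disjoint)
    show "pairwise disjnt (pairs \<pi>)"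
      unfolding pairwise_def disjnt_def pairs_def using P12_block_unique[OF \<pi>] by blast
    show "finite B" if "B \<in> pairs \<pi>" for B
      using that unfolding pairs_def by (metis (mono_tags, lifting) card.infinite mem_Collect_eq zero_neq_numeral)
  qed
  also have "\<dots> = (\<Sum>B\<in>pairs \<pi>. 2)" by (rule sum.cong) (auto simp: pairs_def)
  finally show ?thesis unfolding pair_supp_def by simp
qed

section \<open>The expectation as a signed sum over involutions\<close>

text \<open>
  The cycles of the erased permutation are the nonempty sets \<open>c - S\<close>; each cycle inside \<open>S\<close> is
  lost and contributes \<open>P\<^sub>0 = N\<close>.
\<close>

lemma gap_psum_erase:
  assumes fin: "finite A" and perm: "\<sigma> permutes A" and "S \<subseteq> A"
  defines "B \<equiv> A - S" and "\<rho> \<equiv> erase S \<sigma>"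
  shows "cyc B \<rho> \<le> cyc A \<sigma>"
    and "gap_psum N A S \<sigma> x = of_nat N ^ (cyc A \<sigma> - cyc B \<rho>) * psum_perm N (card B) (relabel B \<rho>) x"
    and "relabel B \<rho> permutes {1..card B}"
proof -
  let ?C = "cycles_on A \<sigma>"
  let ?C1 = "{c\<in>?C. c - S \<noteq> {}}"
  note self = self_in_orbit[OF fin perm]
  have finB: "finite B" using fin by (simp add: B_def)
  have orb: "orbit \<rho> y = orbit \<sigma> y - S" if "y \<in> B" for y
    unfolding \<rho>_def using that by (intro orbit_erase self) (simp add: B_def)
  have finC: "finite ?C" by (rule finite_cycles_on[OF fin perm])
  have cycB: "cycles_on B \<rho> = (\<lambda>c. c - S) ` ?C1"
  proof (intro equalityI subsetI)
    fix c assume "c \<in> cycles_on B \<rho>"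
    then obtain y where y: "y \<in> B" "c = orbit \<sigma> y - S"
      unfolding cycles_on_def using orb by blast
    then have "orbit \<sigma> y \<in> ?C1" using self[of y] by (auto simp: B_def cycles_on_def)
    then show "c \<in> (\<lambda>c. c - S) ` ?C1" using y(2) by blast
  next
    fix c assume "c \<in> (\<lambda>c. c - S) ` ?C1"
    then obtain d y where d: "c = d - S" "d \<in> ?C" "y \<in> d" "y \<notin> S" by blast
    have "d = orbit \<sigma> y" "y \<in> A" using cycles_on_memD[OF fin perm d(2,3)] .
    then have "y \<in> B" "c = orbit \<rho> y" using orb d(1,4) by (simp_all add: B_def)
    then show "c \<in> cycles_on B \<rho>" unfolding cycles_on_def by blast
  qed
  have inj: "inj_on (\<lambda>c. c - S) ?C1"
  proof (rule inj_onI)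
    fix c d assume c: "c \<in> ?C1" and d: "d \<in> ?C1" and eq: "c - S = d - S"
    then obtain y where y: "y \<in> c" "y \<in> d" by blast
    have "c = orbit \<sigma> y" "d = orbit \<sigma> y"
      using cycles_on_memD(1)[OF fin perm] c d y by blast+
    then show "c = d" by simp
  qed
  have cc: "cyc B \<rho> = card ?C1"
    unfolding cyc_def cycB by (rule card_image[OF inj])
  then show le: "cyc B \<rho> \<le> cyc A \<sigma>"
    unfolding cyc_def[of A] using finC by (auto intro: card_mono)
  have bij: "bij_betw \<rho> B B"
    unfolding \<rho>_def B_def by (rule bij_betw_erase[OF fin perm])
  show "relabel B \<rho> permutes {1..card B}" by (rule relabel_permutes[OF finB bij])
  have "psum_perm N (card B) (relabel B \<rho>) x = (\<Prod>c\<in>cycles_on B \<rho>. power_sum N (card c) x)"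
    by (rule psum_perm_relabel[OF finB bij]) (use orb self in \<open>simp add: B_def\<close>)
  also have "\<dots> = (\<Prod>c\<in>?C1. power_sum N (card (c - S)) x)"
    unfolding cycB by (rule prod.reindex_cong[OF inj refl refl])
  finally have ps: "psum_perm N (card B) (relabel B \<rho>) x = (\<Prod>c\<in>?C1. power_sum N (card (c - S)) x)" .
  have "gap_psum N A S \<sigma> x = (\<Prod>c\<in>?C - ?C1. power_sum N (card (c - S)) x) * (\<Prod>c\<in>?C1. power_sum N (card (c - S)) x)"
    unfolding gap_psum_def by (rule prod.subset_diff[OF _ finC]) blast
  also have "(\<Prod>c\<in>?C - ?C1. power_sum N (card (c - S)) x) = (\<Prod>c\<in>?C - ?C1. of_nat N)"
  proof (rule prod.cong[OF refl])
    fix c assume "c \<in> ?C - ?C1"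
    then have "c - S = {}" by blast
    then have "card (c - S) = 0" by (simp only: card.empty)
    then show "power_sum N (card (c - S)) x = of_nat N" by (simp add: power_sum_def)
  qed
  also have "\<dots> = of_nat N ^ (cyc A \<sigma> - cyc B \<rho>)"
    unfolding cc cyc_def[of A] using finC by (simp add: card_Diff_subset)
  finally show "gap_psum N A S \<sigma> x = of_nat N ^ (cyc A \<sigma> - cyc B \<rho>) * psum_perm N (card B) (relabel B \<rho>) x"
    unfolding ps .
qed

lemma rescale_factor:
  fixes a b l N :: nat and q r :: real
  assumes "N \<ge> 1" "q = 1 / real N" "a \<le> b" "r\<^sup>2 = real N"
  shows "r ^ (2 * l) * q powi (int a - int b + int l) = real N ^ (b - a)"
proof -
  have N: "real N \<noteq> 0" using assms(1) by simp
  have q: "q \<noteq> 0" using N assms(2) by simp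
  have "q powi (int a - int b + int l) = q ^ a / q ^ b * q ^ l"
    using q by (simp add: power_int_add power_int_diff)
  also have "q ^ b = q ^ a * q ^ (b - a)" using assms(3) by (simp flip: power_add)
  also have "q ^ a / (q ^ a * q ^ (b - a)) * q ^ l = real N ^ (b - a) / real N ^ l"
    using q N by (simp add: assms(2) power_divide)
  finally show ?thesis using N by (simp add: power_mult assms(4))
qed

definition wick_sign :: "(nat \<Rightarrow> nat) \<Rightarrow> complex" where
  "wick_sign p = (- 1) ^ (card (msupp p) div 2)"

definition wick_term :: "nat \<Rightarrow> nat \<Rightarrow> (nat \<Rightarrow> nat) \<Rightarrow> (nat \<Rightarrow> nat) \<Rightarrow> (nat \<Rightarrow> complex) \<Rightarrow> complex" where
  "wick_term N n \<alpha> p = gap_psum N {1..n} (msupp p) (p \<circ> \<alpha>)"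

lemma finite_SymGrp: "finite (SymGrp n)"
  unfolding SymGrp_def by (simp add: finite_permutations)

lemma comp_permutes:
  assumes "\<alpha> \<in> SymGrp n" "p \<in> invols n"
  shows "p \<circ> \<alpha> permutes {1..n}"
  using assms unfolding SymGrp_def invols_def by (auto intro: permutes_compose)

lemma psum_contraction:
  fixes q r :: real
  assumes N: "N \<ge> 1" "q = 1 / real N" "r\<^sup>2 = real N" and \<pi>: "\<pi> \<in> P12 n"
  shows "complex_of_real (r ^ (2 * card (pairs \<pi>))) * psum N (n - 2 * card (pairs \<pi>)) (contraction q n \<pi> \<eta>) x
    = (\<Sum>\<alpha>\<in>SymGrp n. \<eta> \<alpha> * wick_term N n \<alpha> (pair_invol \<pi>) x)"
proof -
  let ?p = "pair_invol \<pi>" and ?S = "pair_supp \<pi>" and ?l = "card (pairs \<pi>)"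
  let ?B = "{1..n} - ?S"
  let ?\<rho> = "\<lambda>\<alpha>. erase ?S (?p \<circ> \<alpha>)"
  let ?w = "\<lambda>\<alpha>. q powi (int (cyc ?B (?\<rho> \<alpha>)) - int (cyc {1..n} (?p \<circ> \<alpha>)) + int ?l)"
  have sub: "?S \<subseteq> {1..n}" by (rule pair_supp_subset[OF \<pi>])
  have card: "card ?B = n - 2 * ?l"
    using sub card_pair_supp[OF \<pi>] by (simp add: card_Diff_subset finite_subset)
  have perm: "?p \<circ> \<alpha> permutes {1..n}" if "\<alpha> \<in> SymGrp n" for \<alpha>
    by (rule comp_permutes[OF that pair_invol_in_invols[OF \<pi>]])
  note gap = gap_psum_erase[OF finite_atLeastAtMost perm sub]
  have "psum N (n - 2 * ?l) (contraction q n \<pi> \<eta>) x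
      = (\<Sum>\<beta>\<in>SymGrp (n - 2 * ?l). \<Sum>\<alpha>\<in>SymGrp n. \<eta> \<alpha> * (of_real (?w \<alpha>) *
          (gunit (relabel ?B (?\<rho> \<alpha>)) \<beta> * psum_perm N (n - 2 * ?l) \<beta> x)))"
    unfolding psum_def contraction_def contraction_perm_def Let_def sum_distrib_right
    by (simp only: mult.assoc)
  also have "\<dots> = (\<Sum>\<alpha>\<in>SymGrp n. \<Sum>\<beta>\<in>SymGrp (n - 2 * ?l). \<eta> \<alpha> * (of_real (?w \<alpha>) *
          (gunit (relabel ?B (?\<rho> \<alpha>)) \<beta> * psum_perm N (n - 2 * ?l) \<beta> x)))"
    by (rule sum.swap)
  also have "\<dots> = (\<Sum>\<alpha>\<in>SymGrp n. \<eta> \<alpha> * (of_real (?w \<alpha>) * psum_perm N (n - 2 * ?l) (relabel ?B (?\<rho> \<alpha>)) x))"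
  proof (rule sum.cong[OF refl])
    fix \<alpha> assume \<alpha>: "\<alpha> \<in> SymGrp n"
    let ?\<beta> = "relabel ?B (?\<rho> \<alpha>)"
    have mem: "?\<beta> \<in> SymGrp (n - 2 * ?l)"
      using gap(3)[OF \<alpha>] unfolding card SymGrp_def by blast
    have "(\<Sum>\<beta>\<in>SymGrp (n - 2 * ?l). gunit ?\<beta> \<beta> * psum_perm N (n - 2 * ?l) \<beta> x)
        = (\<Sum>\<beta>\<in>SymGrp (n - 2 * ?l). if \<beta> = ?\<beta> then psum_perm N (n - 2 * ?l) \<beta> x else 0)"
      unfolding gunit_def by (intro sum.cong refl) simp
    also have "\<dots> = psum_perm N (n - 2 * ?l) ?\<beta> x"
      using mem by (subst sum.delta[OF finite_SymGrp]) (simp only: if_True)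
    finally show "(\<Sum>\<beta>\<in>SymGrp (n - 2 * ?l). \<eta> \<alpha> * (of_real (?w \<alpha>) *
          (gunit ?\<beta> \<beta> * psum_perm N (n - 2 * ?l) \<beta> x)))
        = \<eta> \<alpha> * (of_real (?w \<alpha>) * psum_perm N (n - 2 * ?l) ?\<beta> x)"
      unfolding sum_distrib_left[symmetric] by (simp only:)
  qed
  finally have ps: "psum N (n - 2 * ?l) (contraction q n \<pi> \<eta>) x
      = (\<Sum>\<alpha>\<in>SymGrp n. \<eta> \<alpha> * (of_real (?w \<alpha>) * psum_perm N (n - 2 * ?l) (relabel ?B (?\<rho> \<alpha>)) x))" .
  show ?thesis
    unfolding ps sum_distrib_left
  proof (rule sum.cong[OF refl])
    fix \<alpha> assume \<alpha>: "\<alpha> \<in> SymGrp n"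
    have "complex_of_real (r ^ (2 * ?l)) * of_real (?w \<alpha>) = of_nat N ^ (cyc {1..n} (?p \<circ> \<alpha>) - cyc ?B (?\<rho> \<alpha>))"
      unfolding of_real_mult[symmetric] rescale_factor[OF N(1,2) gap(1)[OF \<alpha>] N(3)] by simp
    then have "complex_of_real (r ^ (2 * ?l)) * (of_real (?w \<alpha>) * psum_perm N (n - 2 * ?l) (relabel ?B (?\<rho> \<alpha>)) x)
        = wick_term N n \<alpha> ?p x"
      unfolding wick_term_def msupp_pair_invol[OF \<pi>] gap(2)[OF \<alpha>] card mult.assoc[symmetric] by (simp only:)
    then show "complex_of_real (r ^ (2 * ?l)) * (\<eta> \<alpha> * (of_real (?w \<alpha>) * psum_perm N (n - 2 * ?l) (relabel ?B (?\<rho> \<alpha>)) x))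
        = \<eta> \<alpha> * wick_term N n \<alpha> ?p x"
      by (simp only: mult.left_commute)
  qed
qed

lemma expect_W_eq:
  fixes h :: "'h::real_inner"
  assumes "N \<ge> 1" "q = 1 / real N" "(norm h)\<^sup>2 = real N"
  shows "expect_W q N n \<eta> h x = (\<Sum>p\<in>invols n. \<Sum>\<alpha>\<in>SymGrp n. \<eta> \<alpha> * wick_sign p * wick_term N n \<alpha> p x)"
proof -
  have "expect_W q N n \<eta> h x = (\<Sum>\<pi>\<in>P12 n. (\<lambda>p. \<Sum>\<alpha>\<in>SymGrp n. \<eta> \<alpha> * wick_sign p * wick_term N n \<alpha> p x) (pair_invol \<pi>))"
    unfolding expect_W_def
  proof (rule sum.cong[OF refl])
    fix \<pi> assume \<pi>: "\<pi> \<in> P12 n"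
    have sgn: "wick_sign (pair_invol \<pi>) = (- 1) ^ card (pairs \<pi>)"
      unfolding wick_sign_def msupp_pair_invol[OF \<pi>] card_pair_supp[OF \<pi>] by simp
    show "(- 1) ^ card (pairs \<pi>) * complex_of_real (norm h ^ (2 * card (pairs \<pi>)))
          * psum N (n - 2 * card (pairs \<pi>)) (contraction q n \<pi> \<eta>) x
        = (\<Sum>\<alpha>\<in>SymGrp n. \<eta> \<alpha> * wick_sign (pair_invol \<pi>) * wick_term N n \<alpha> (pair_invol \<pi>) x)"
      unfolding mult.assoc psum_contraction[OF assms \<pi>] sgn sum_distrib_left
      by (simp only: mult.left_commute)
  qed
  also have "\<dots> = (\<Sum>p\<in>invols n. \<Sum>\<alpha>\<in>SymGrp n. \<eta> \<alpha> * wick_sign p * wick_term N n \<alpha> p x)"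
    by (rule sum.reindex_bij_betw[OF bij_betw_pair_invol])
  finally show ?thesis .
qed

text \<open>
  Adding a pair flips the sign, so after regrouping by the enlarged involution, \<open>D\<^sup>*\<close> contributes
  the summand of \<open>p\<close> multiplied by minus the size of its support, exactly what its degree lacks to \<open>n\<close>.
\<close>

lemma wick_eigen:
  assumes inj: "inj_on x {1..N}" and \<alpha>: "\<alpha> \<in> SymGrp n"
  shows "(\<Sum>p\<in>invols n. wick_sign p * (D_star N (wick_term N n \<alpha> p) x - E_star N (wick_term N n \<alpha> p) x))
    = - of_nat n * (\<Sum>p\<in>invols n. wick_sign p * wick_term N n \<alpha> p x)"
proof -
  let ?T = "\<lambda>p. wick_term N n \<alpha> p x" and ?A = "{1..n}"
  note gap = finite_atLeastAtMost[of 1 n] comp_permutes[OF \<alpha>]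
  have "(\<Sum>p\<in>invols n. wick_sign p * D_star N (wick_term N n \<alpha> p) x)
      = (\<Sum>p\<in>invols n. \<Sum>a\<in>?A - msupp p. \<Sum>b\<in>?A - msupp p - {a}.
          - (wick_sign (Transposition.transpose a b \<circ> p) * ?T (Transposition.transpose a b \<circ> p)))"
  proof (rule sum.cong[OF refl])
    fix p assume p: "p \<in> invols n"
    have "D_star N (wick_term N n \<alpha> p) x = (\<Sum>a\<in>?A - msupp p. \<Sum>b\<in>?A - msupp p - {a}.
        gap_psum N ?A (msupp p \<union> {a, b}) (Transposition.transpose a b \<circ> (p \<circ> \<alpha>)) x)"
      unfolding wick_term_def by (rule D_star_gap_psum[OF gap(1) gap(2)[OF p] inj])
    then show "wick_sign p * D_star N (wick_term N n \<alpha> p) x = (\<Sum>a\<in>?A - msupp p. \<Sum>b\<in>?A - msupp p - {a}.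
          - (wick_sign (Transposition.transpose a b \<circ> p) * ?T (Transposition.transpose a b \<circ> p)))"
      unfolding sum_distrib_left
    proof (simp only: sum_distrib_left, intro sum.cong refl)
      fix a b assume "a \<in> ?A - msupp p" "b \<in> ?A - msupp p - {a}"
      then have ab: "a \<in> ?A" "b \<in> ?A" "a \<noteq> b" "p a = a" "p b = b"
        unfolding msupp_def by blast+
      have sgn: "wick_sign (Transposition.transpose a b \<circ> p) = - wick_sign p"
        unfolding wick_sign_def card_msupp_transpose[OF p ab] by simp
      show "wick_sign p * gap_psum N ?A (msupp p \<union> {a, b}) (Transposition.transpose a b \<circ> (p \<circ> \<alpha>)) x
          = - (wick_sign (Transposition.transpose a b \<circ> p) * ?T (Transposition.transpose a b \<circ> p))"
        unfolding sgn wick_term_def msupp_transpose[OF p ab] comp_assoc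
        by simp
    qed
  qed
  also have "\<dots> = (\<Sum>p\<in>invols n. of_nat (card (msupp p)) * - (wick_sign p * ?T p))"
    by (rule sum_invols_insert)
  finally have D: "(\<Sum>p\<in>invols n. wick_sign p * D_star N (wick_term N n \<alpha> p) x)
      = (\<Sum>p\<in>invols n. of_nat (card (msupp p)) * - (wick_sign p * ?T p))" .
  have E: "E_star N (wick_term N n \<alpha> p) x = (of_nat n - of_nat (card (msupp p))) * ?T p" if p: "p \<in> invols n" for p
  proof -
    have s: "msupp p \<subseteq> ?A" by (rule msupp_subset[OF p])
    then have "card (?A - msupp p) = n - card (msupp p)" "card (msupp p) \<le> n"
      using card_mono[OF _ s] by (simp_all add: card_Diff_subset finite_subset)
    then show ?thesis
      unfolding wick_term_def E_star_gap_psum[OF gap(1) gap(2)[OF p]] by (simp add: of_nat_diff)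
  qed
  have "(\<Sum>p\<in>invols n. wick_sign p * (D_star N (wick_term N n \<alpha> p) x - E_star N (wick_term N n \<alpha> p) x))
    = (\<Sum>p\<in>invols n. of_nat (card (msupp p)) * - (wick_sign p * ?T p))
      - (\<Sum>p\<in>invols n. wick_sign p * ((of_nat n - of_nat (card (msupp p))) * ?T p))"
    unfolding right_diff_distrib sum_subtractf D by (simp only: E cong: sum.cong)
  also have "\<dots> = (\<Sum>p\<in>invols n. - of_nat n * (wick_sign p * ?T p))"
    unfolding sum_subtractf[symmetric] by (intro sum.cong refl) (simp add: algebra_simps)
  finally show ?thesis by (simp only: sum_distrib_left)
qed

section \<open>Existence and the theorem\<close>

lemma poly_below_wick_term:
  assumes "\<alpha> \<in> SymGrp n" "p \<in> invols n"
  shows "poly_below N (Suc (n - card (msupp p))) (wick_term N n \<alpha> p)"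
proof -
  have "msupp p \<subseteq> {1..n}" by (rule msupp_subset[OF assms(2)])
  then have "card ({1..n} - msupp p) = n - card (msupp p)"
    by (simp add: card_Diff_subset finite_subset)
  then show ?thesis
    using poly_below_gap_psum[OF finite_atLeastAtMost comp_permutes[OF assms], of N "msupp p"]
    unfolding wick_term_def by (simp only:)
qed

lemma wick_term_id: "wick_term N n \<alpha> id x = psum_perm N n \<alpha> x"
  by (simp add: wick_term_def msupp_def gap_psum_def psum_perm_def power_sum_def)

lemma is_hermite_expect_W:
  fixes h :: "'h::real_inner"
  assumes "N \<ge> 1" "q = 1 / real N" "(norm h)\<^sup>2 = real N"
  shows "is_hermite N n lam (\<lambda>x. 1 / of_nat (hook_prod lam) * expect_W q N n (irr_char n lam) h x)"
proof -
  let ?k = "1 / of_nat (hook_prod lam) :: complex"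
  let ?\<eta> = "irr_char n lam"
  let ?H = "\<lambda>x. ?k * expect_W q N n ?\<eta> h x"
  let ?w = "\<lambda>z. ?k * (?\<eta> (snd z) * wick_sign (fst z))"
  let ?f = "\<lambda>z. wick_term N n (snd z) (fst z)"
  let ?J = "invols n \<times> SymGrp n" and ?J' = "(invols n - {id}) \<times> SymGrp n"
  have finJ: "finite ?J" by (intro finite_cartesian_product finite_invols finite_SymGrp)
  have Hx: "?k * expect_W q N n ?\<eta> h x = (\<Sum>z\<in>?J. ?w z * ?f z x)" for x
    unfolding expect_W_eq[OF assms] sum.cartesian_product sum_distrib_left
    by (simp only: case_prod_beta mult.assoc)
  then have H: "?H = (\<lambda>x. \<Sum>z\<in>?J. ?w z * ?f z x)" by (rule ext)
  have pb: "poly_below N (Suc n) (?f z)" if "z \<in> ?J" for z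
    by (rule poly_below_mono[OF poly_below_wick_term]) (use that in auto)
  have "poly_below N (Suc n) ?H"
    unfolding H by (rule poly_below_sum[OF finJ pb])
  moreover have "?H (x \<circ> \<sigma>) = ?H x" if "\<sigma> permutes {1..N}" for \<sigma> x
    unfolding Hx wick_term_def gap_psum_permute[OF that] ..
  ultimately have 1: "sym_poly N ?H" unfolding sym_poly_def by blast
  have 2: "D_star N ?H x - E_star N ?H x = - of_nat n * ?H x" if inj: "inj_on x {1..N}" for x
  proof -
    have D: "D_star N ?H x = (\<Sum>z\<in>?J. ?w z * D_star N (?f z) x)"
      unfolding H by (rule D_star_sum[OF pb])
    have E: "E_star N ?H x = (\<Sum>z\<in>?J. ?w z * E_star N (?f z) x)"
      unfolding H by (rule E_star_sum[OF pb])
    have "D_star N ?H x - E_star N ?H x = (\<Sum>z\<in>?J. ?w z * (D_star N (?f z) x - E_star N (?f z) x))"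
      unfolding D E by (simp only: sum_subtractf right_diff_distrib)
    also have "\<dots> = (\<Sum>p\<in>invols n. \<Sum>\<alpha>\<in>SymGrp n. ?k * (?\<eta> \<alpha> * wick_sign p) *
        (D_star N (wick_term N n \<alpha> p) x - E_star N (wick_term N n \<alpha> p) x))"
      unfolding sum.cartesian_product case_prod_unfold ..
    also have "\<dots> = (\<Sum>\<alpha>\<in>SymGrp n. \<Sum>p\<in>invols n. ?k * (?\<eta> \<alpha> * wick_sign p) *
        (D_star N (wick_term N n \<alpha> p) x - E_star N (wick_term N n \<alpha> p) x))"
      by (rule sum.swap)
    also have "\<dots> = (\<Sum>\<alpha>\<in>SymGrp n. ?k * ?\<eta> \<alpha> * (\<Sum>p\<in>invols n. wick_sign p *
        (D_star N (wick_term N n \<alpha> p) x - E_star N (wick_term N n \<alpha> p) x)))"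
      by (simp only: sum_distrib_left mult.assoc)
    also have "\<dots> = (\<Sum>\<alpha>\<in>SymGrp n. ?k * ?\<eta> \<alpha> * (- of_nat n * (\<Sum>p\<in>invols n. wick_sign p * wick_term N n \<alpha> p x)))"
      by (intro sum.cong refl) (simp only: wick_eigen[OF inj])
    also have "\<dots> = - of_nat n * (\<Sum>\<alpha>\<in>SymGrp n. \<Sum>p\<in>invols n. ?k * (?\<eta> \<alpha> * wick_sign p * wick_term N n \<alpha> p x))"
      unfolding sum_distrib_left by (intro sum.cong refl) (simp only: ac_simps)
    also have "(\<Sum>\<alpha>\<in>SymGrp n. \<Sum>p\<in>invols n. ?k * (?\<eta> \<alpha> * wick_sign p * wick_term N n \<alpha> p x)) = ?H x"
      unfolding expect_W_eq[OF assms] sum_distrib_left by (rule sum.swap)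
    finally show ?thesis .
  qed
  have id: "id \<in> invols n" by (simp add: invols_def)
  \<comment> \<open>the summand of the identity involution is the leading term\<close>
  have "?H x - fact n / of_nat (hook_prod lam) * schur N n lam x = (\<Sum>z\<in>?J'. ?w z * ?f z x)" for x
  proof -
    have "?H x = (\<Sum>p\<in>invols n. \<Sum>\<alpha>\<in>SymGrp n. ?k * (?\<eta> \<alpha> * wick_sign p * wick_term N n \<alpha> p x))"
      unfolding expect_W_eq[OF assms] sum_distrib_left ..
    also have "\<dots> = (\<Sum>\<alpha>\<in>SymGrp n. ?k * (?\<eta> \<alpha> * wick_sign id * wick_term N n \<alpha> id x))
        + (\<Sum>p\<in>invols n - {id}. \<Sum>\<alpha>\<in>SymGrp n. ?k * (?\<eta> \<alpha> * wick_sign p * wick_term N n \<alpha> p x))"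
      by (rule sum.remove[OF finite_invols id])
    also have "(\<Sum>\<alpha>\<in>SymGrp n. ?k * (?\<eta> \<alpha> * wick_sign id * wick_term N n \<alpha> id x))
        = fact n / of_nat (hook_prod lam) * schur N n lam x"
      by (simp add: schur_def wick_term_id wick_sign_def msupp_def sum_distrib_left)
    also have "(\<Sum>p\<in>invols n - {id}. \<Sum>\<alpha>\<in>SymGrp n. ?k * (?\<eta> \<alpha> * wick_sign p * wick_term N n \<alpha> p x))
        = (\<Sum>z\<in>?J'. ?w z * ?f z x)"
      unfolding sum.cartesian_product by (simp only: case_prod_unfold mult.assoc)
    finally show ?thesis by simp
  qed
  moreover have "poly_below N n (\<lambda>x. \<Sum>z\<in>?J'. ?w z * ?f z x)"
  proof (rule poly_below_sum)
    show "finite ?J'" using finite_invols finite_SymGrp by (intro finite_cartesian_product) auto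
    fix z assume "z \<in> ?J'"
    then have z: "snd z \<in> SymGrp n" "fst z \<in> invols n" "fst z \<noteq> id" by auto
    have sub: "msupp (fst z) \<subseteq> {1..n}" by (rule msupp_subset[OF z(2)])
    obtain y where "fst z y \<noteq> y" using z(3) by (metis ext id_apply)
    then have "msupp (fst z) \<noteq> {}" unfolding msupp_def by blast
    then have "0 < card (msupp (fst z))" "card (msupp (fst z)) \<le> n"
      using sub card_mono[OF _ sub] by (simp_all add: card_gt_0_iff finite_subset)
    then show "poly_below N n (?f z)"
      by (intro poly_below_mono[OF poly_below_wick_term[OF z(1,2)]]) linarith
  qed
  ultimately have 3: "poly_below N n (\<lambda>x. ?H x - fact n / of_nat (hook_prod lam) * schur N n lam x)"
    by (simp only:)
  show ?thesis unfolding is_hermite_def using 1 2 3 by blast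
qed

theorem mainTheorem16:
  fixes N n :: nat and q :: real and lam :: "nat list"
    and h :: "'h::{real_inner, complete_space}"
  assumes "N \<ge> 1" and "q = 1 / real N" and "lam \<in> Par n" and "(norm h)\<^sup>2 = real N"
  shows "(\<exists>!H. is_hermite N n lam H) \<and>
         (\<exists>c. expect_W q N n (irr_char n lam) h = (\<lambda>x. c * hermite_matrix N n lam x))"
proof -
  let ?H = "\<lambda>x. 1 / of_nat (hook_prod lam) * expect_W q N n (irr_char n lam) h x"
  have H: "is_hermite N n lam ?H" by (rule is_hermite_expect_W[OF assms(1,2,4)])
  have ex1: "\<exists>!H. is_hermite N n lam H"
    by (rule ex1I[of "is_hermite N n lam", OF H]) (rule is_hermite_unique[OF _ H])
  have "hook_prod lam \<noteq> 0" by (simp add: hook_prod_def)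
  then have hook: "of_nat (hook_prod lam) \<noteq> (0 :: complex)" unfolding of_nat_eq_0_iff .
  have herm: "hermite_matrix N n lam = ?H"
    unfolding hermite_matrix_def by (rule the1_equality[of "is_hermite N n lam", OF ex1 H])
  have "expect_W q N n (irr_char n lam) h x = of_nat (hook_prod lam) * hermite_matrix N n lam x" for x
    unfolding herm using hook by simp
  then have "expect_W q N n (irr_char n lam) h = (\<lambda>x. of_nat (hook_prod lam) * hermite_matrix N n lam x)"
    by (rule ext)
  with ex1 show ?thesis by blast
qed

end
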